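(* Let $H$ be a nonzero complex Hilbert space (of arbitrary dimension), and let $\lambda$ be the $\lambda$-function of Aron and Lohman on the closed unit ball $\mathcal{B}_{C_1(H)}$ of the space $C_1(H)$ of trace class operators on $H$. Then for every $a\in \mathcal{B}_{C_1(H)}$, $$\lambda(a) = \frac{1-\|a\|_1+2\|a\|_{\infty}}{2}.$$ Moreover, $\lambda(a)$ is attained, that is, for every $a\in\mathcal{B}_{C_1(H)}$ there exist $e\in\partial_e(\mathcal{B}_{C_1(H)})$ and $y\in\mathcal{B}_{C_1(H)}$ such that $a=\lambda(a)\,e+(1-\lambda(a))\,y$.
   Context: $C_1(H)$ is the Banach space of trace class operators on $H$, i.e. compact operators $a$ on $H$ with $\|a\|_1:=\mathrm{tr}(|a|)<\infty$, where $|a|=(a^*a)^{1/2}$, equipped with the norm $\|\cdot\|_1$. $\|a\|_{\infty}$ denotes the operator norm of $a$ as an element of $B(H)$. For a Banach space $X$, $\mathcal{B}_X$ denotes its closed unit ball and $\partial_e(\mathcal{B}_X)$ the set of extreme points of $\mathcal{B}_X$, assumed nonempty. A triplet $(e,y,t)\in\partial_e(\mathcal{B}_X)\times\mathcal{B}_X\times[0,1]$ is amenable to $x\in\mathcal{B}_X$ if $x=te+(1-t)y$. The $\lambda$-function $\lambda:\mathcal{B}_X\to[0,\infty)$ is defined by $$\lambda(x):=\sup\{t : (e,y,t)\in\partial_e(\mathcal{B}_X)\times\mathcal{B}_X\times[0,1]\text{ is amenable to }x\}.$$ Here $X=C_1(H)$ with the norm $\|\cdot\|_1$. *)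

theory Defs
  imports "HOL-Analysis.Analysis"
begin

section \<open>Complex Hilbert spaces\<close>

text \<open>
  A complex inner product space is presented together with its underlying real inner product
  space: the axioms \<open>scaleR_eq_scaleC\<close> and \<open>inner_eq_Re_cinner\<close> determine the real structure
  (hence also the norm, metric and topology) from the complex one. The inner product is linear in
  the first argument.
\<close>

class complex_inner = real_inner +
  fixes scaleC :: "complex \<Rightarrow> 'a \<Rightarrow> 'a"  (infixr "*\<^sub>C" 75)
    and cinner :: "'a \<Rightarrow> 'a \<Rightarrow> complex"
  assumes scaleC_add_right: "c *\<^sub>C (x + y) = c *\<^sub>C x + c *\<^sub>C y"
    and scaleC_add_left: "(c + d) *\<^sub>C x = c *\<^sub>C x + d *\<^sub>C x"
    and scaleC_scaleC: "c *\<^sub>C d *\<^sub>C x = (c * d) *\<^sub>C x"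
    and scaleC_one: "1 *\<^sub>C x = x"
    and scaleR_eq_scaleC: "r *\<^sub>R x = complex_of_real r *\<^sub>C x"
    and cinner_commute: "cinner x y = cnj (cinner y x)"
    and cinner_add_left: "cinner (x + y) z = cinner x z + cinner y z"
    and cinner_scaleC_left: "cinner (c *\<^sub>C x) y = c * cinner x y"
    and inner_eq_Re_cinner: "inner x y = Re (cinner x y)"

class complex_hilbert_space = complex_inner + complete_space

instantiation complex :: complex_hilbert_space
begin

definition scaleC_complex :: "complex \<Rightarrow> complex \<Rightarrow> complex"
  where "scaleC_complex c x = c * x"

definition cinner_complex :: "complex \<Rightarrow> complex \<Rightarrow> complex"
  where "cinner_complex x y = x * cnj y"

instance
  by standard
    (simp_all add: scaleC_complex_def cinner_complex_def algebra_simps scaleR_conv_of_real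
      inner_complex_def)

end


section \<open>Bounded operators on a complex Hilbert space\<close>

text \<open>
  The type \<open>'h \<Rightarrow>\<^sub>L 'h\<close> consists of the bounded real-linear maps, normed by the operator norm;
  \<open>B(H)\<close> is its subspace of complex-linear maps.
\<close>

definition bounded_operators :: "('h::complex_hilbert_space \<Rightarrow>\<^sub>L 'h) set"
  where "bounded_operators =
    {a. \<forall>c x. blinfun_apply a (c *\<^sub>C x) = c *\<^sub>C blinfun_apply a x}"

definition cadjoint ::
    "('h::complex_hilbert_space \<Rightarrow>\<^sub>L 'h) \<Rightarrow> ('h \<Rightarrow>\<^sub>L 'h)"
  where "cadjoint a = (THE b. b \<in> bounded_operators \<and>
    (\<forall>x y. cinner (blinfun_apply a x) y = cinner x (blinfun_apply b y)))"

definition positive_operator :: "('h::complex_hilbert_space \<Rightarrow>\<^sub>L 'h) \<Rightarrow> bool"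
  where "positive_operator s \<longleftrightarrow> s \<in> bounded_operators \<and>
    (\<forall>x. cinner (blinfun_apply s x) x \<in> \<real>\<^sub>\<ge>\<^sub>0)"

definition sqrt_operator ::
    "('h::complex_hilbert_space \<Rightarrow>\<^sub>L 'h) \<Rightarrow> ('h \<Rightarrow>\<^sub>L 'h)"
  where "sqrt_operator p = (THE s. positive_operator s \<and> s o\<^sub>L s = p)"

definition abs_operator ::
    "('h::complex_hilbert_space \<Rightarrow>\<^sub>L 'h) \<Rightarrow> ('h \<Rightarrow>\<^sub>L 'h)"
  where "abs_operator a = sqrt_operator (cadjoint a o\<^sub>L a)"

definition compact_operator :: "('h::complex_hilbert_space \<Rightarrow>\<^sub>L 'h) \<Rightarrow> bool"
  where "compact_operator a \<longleftrightarrow> a \<in> bounded_operators \<and>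
    compact (closure (blinfun_apply a ` cball 0 1))"


section \<open>Trace class operators\<close>

definition orthonormal_basis :: "'h::complex_hilbert_space set \<Rightarrow> bool"
  where "orthonormal_basis E \<longleftrightarrow>
    (\<forall>e\<in>E. norm e = 1) \<and>
    (\<forall>e\<in>E. \<forall>f\<in>E. e \<noteq> f \<longrightarrow> cinner e f = 0) \<and>
    (\<forall>x. (\<forall>e\<in>E. cinner x e = 0) \<longrightarrow> x = 0)"

text \<open>
  The trace of a positive operator, with values in \<open>[0, \<infinity>]\<close>; it does not depend on the
  orthonormal basis chosen.
\<close>

definition positive_trace :: "('h::complex_hilbert_space \<Rightarrow>\<^sub>L 'h) \<Rightarrow> ennreal"
  where "positive_trace p =
    (\<Sum>\<^sub>\<infinity>e\<in>(SOME E. orthonormal_basis E). ennreal (Re (cinner (blinfun_apply p e) e)))"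

definition trace_class :: "('h::complex_hilbert_space \<Rightarrow>\<^sub>L 'h) set"
  where "trace_class = {a. compact_operator a \<and> positive_trace (abs_operator a) < \<infinity>}"

definition trace_norm :: "('h::complex_hilbert_space \<Rightarrow>\<^sub>L 'h) \<Rightarrow> real"
  where "trace_norm a = enn2real (positive_trace (abs_operator a))"

definition trace_class_ball :: "('h::complex_hilbert_space \<Rightarrow>\<^sub>L 'h) set"
  where "trace_class_ball = {a \<in> trace_class. trace_norm a \<le> 1}"


section \<open>The lambda-function of Aron and Lohman\<close>

text \<open>
  The definitions depend on the normed space only through its closed unit ball \<open>B\<close>, here a subset
  of an ambient real vector space.
\<close>

definition amenable ::
    "'v::real_vector set \<Rightarrow> 'v \<times> 'v \<times> real \<Rightarrow> 'v \<Rightarrow> bool"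
  where "amenable B = (\<lambda>(e, y, t) x.
    e extreme_point_of B \<and> y \<in> B \<and> t \<in> {0..1} \<and> x = t *\<^sub>R e + (1 - t) *\<^sub>R y)"

definition lambda_function :: "'v::real_vector set \<Rightarrow> 'v \<Rightarrow> real"
  where "lambda_function B x = Sup {t. \<exists>e y. amenable B (e, y, t) x}"

end

theory Submission imports Defs begin

text \<open>
  By the singular value expansion, the trace norm of a compact operator \<open>a\<close> is the supremum of
  \<open>\<Sum> Re \<langle>a x\<^sub>i, y\<^sub>i\<rangle>\<close> over finite orthonormal families, so all estimates reduce to
  choosing such families. The extreme points of the unit ball are the operators
  \<open>x \<mapsto> \<langle>x, v\<rangle> u\<close> with \<open>u\<close>, \<open>v\<close> unit vectors. With \<open>u\<close>, \<open>v\<close> top singular vectors of \<open>a\<close>,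
  subtracting \<open>\<lambda>\<close> times this operator changes only the top singular value, and the remainder has
  trace norm exactly \<open>1 - \<lambda>\<close>.

  For the upper bound one needs \<open>\<parallel>t e - a\<parallel>\<^sub>1 \<ge> t + \<parallel>a\<parallel>\<^sub>1 - 2 \<parallel>a\<parallel>\<close> for every extreme point \<open>e\<close>.
  Test \<open>t e - a\<close> against singular families \<open>x\<^sub>i\<close>, \<open>R f\<^sub>i\<close> of \<open>a\<close>, where \<open>R\<close> is a complex
  reflection, a perturbation of \<open>- id\<close> of rank one and norm at most \<open>2\<close>, chosen such that \<open>e\<close>
  contributes exactly \<open>t\<close>.
\<close>

section \<open>Complex inner products\<close>

text \<open>If \<open>a = t e + (1 - t) y\<close>, then \<open>t e - a = - (1 - t) y\<close> has
  trace norm at most \<open>1 - t\<close>. Set against the lower bound \<open>t +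
  \<parallel>a\<parallel>\<^sub>1 - 2 \<parallel>a\<parallel>\<close>, this says exactly
  \<open>t \<le> \<lambda>\<close>. The constant comes from the same balance: subtracting
  \<open>\<lambda>\<close> from the top singular value leaves
  \<open>(\<parallel>a\<parallel>\<^sub>1 - \<parallel>a\<parallel>) + (\<lambda> -
  \<parallel>a\<parallel>)\<close>, and equating this with \<open>1 - \<lambda>\<close> gives the
  formula. The part \<open>- id\<close> of \<open>R\<close> lets \<open>- a\<close> contribute a
  full partial sum of singular values; the rank one correction costs at most
  \<open>2 \<parallel>a\<parallel>\<close>. For \<open>e\<close> to contribute \<open>t\<close>,
  \<open>R\<close> must carry to \<open>u\<close> the vector \<open>p\<close> that corresponds to
  \<open>v\<close> under \<open>x\<^sub>i \<mapsto> f\<^sub>i\<close>. This needs \<open>v\<close>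
  in the span of a finite family, which is the main obstacle. A map \<open>2 P - id\<close> with an
  orthogonal projection \<open>P\<close> is self-adjoint and can send \<open>p\<close> to
  \<open>u\<close> only if their inner product is real; hence the complex coefficient. The shape of
  the extreme points is no independent input: since \<open>\<lambda>\<close> is positive, the
  decomposition forces an extreme point to be the rank one operator occurring in it.\<close>

lemma scaleC_zero_left [simp]: "0 *\<^sub>C x = (0::'h::complex_inner)"
  using scaleC_add_left[of 0 0 x] by simp

lemma scaleC_zero_right [simp]: "c *\<^sub>C 0 = (0::'h::complex_inner)"
  using scaleC_add_right[of c "0::'h" 0] by simp

lemma scaleC_minus_left: "(- c) *\<^sub>C x = - (c *\<^sub>C x)" for x :: "'h::complex_inner"
  using scaleC_add_left[of c "-c" x] by (simp add: minus_unique)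

lemma scaleC_minus_right: "c *\<^sub>C (- x) = - (c *\<^sub>C x)" for x :: "'h::complex_inner"
  using scaleC_add_right[of c x "-x"] by (simp add: minus_unique)

lemma scaleC_diff_right: "c *\<^sub>C (x - y) = c *\<^sub>C x - c *\<^sub>C y" for x :: "'h::complex_inner"
  using scaleC_add_right[of c x "-y"] by (simp add: scaleC_minus_right)

lemma scaleC_sum_left: "(\<Sum>i\<in>I. c i) *\<^sub>C x = (\<Sum>i\<in>I. c i *\<^sub>C x)" for x :: "'h::complex_inner"
  by (induction I rule: infinite_finite_induct) (simp_all add: scaleC_add_left)

declare scaleC_one [simp]

lemma cinner_add_right: "cinner x (y + z) = cinner x y + cinner x z" for x :: "'h::complex_inner"
  by (metis cinner_add_left cinner_commute complex_cnj_add)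

lemma cinner_scaleC_right: "cinner x (c *\<^sub>C y) = cnj c * cinner x y" for x :: "'h::complex_inner"
  by (metis cinner_commute cinner_scaleC_left complex_cnj_mult)

lemma cinner_scaleR_left: "cinner (r *\<^sub>R x) y = r * cinner x y" for x :: "'h::complex_inner"
  by (simp add: scaleR_eq_scaleC cinner_scaleC_left)

lemma cinner_scaleR_right: "cinner x (r *\<^sub>R y) = r * cinner x y" for x :: "'h::complex_inner"
  by (simp add: scaleR_eq_scaleC cinner_scaleC_right)

lemma cinner_zero_left [simp]: "cinner 0 x = 0" for x :: "'h::complex_inner"
  using cinner_scaleC_left[of 0 x x] by simp

lemma cinner_zero_right [simp]: "cinner x 0 = 0" for x :: "'h::complex_inner"
  using cinner_scaleC_right[of x 0 x] by simp

lemma cinner_minus_left: "cinner (- x) y = - cinner x y" for x :: "'h::complex_inner"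
  using cinner_scaleC_left[of "-1" x y] by (simp add: scaleC_minus_left)

lemma cinner_minus_right: "cinner x (- y) = - cinner x y" for x :: "'h::complex_inner"
  using cinner_scaleC_right[of x "-1" y] by (simp add: scaleC_minus_left)

lemma cinner_diff_left: "cinner (x - y) z = cinner x z - cinner y z" for x :: "'h::complex_inner"
  using cinner_add_left[of x "-y" z] by (simp add: cinner_minus_left)

lemma cinner_diff_right: "cinner x (y - z) = cinner x y - cinner x z" for x :: "'h::complex_inner"
  using cinner_add_right[of x y "-z"] by (simp add: cinner_minus_right)

lemma cinner_sum_left: "cinner (\<Sum>i\<in>I. x i) y = (\<Sum>i\<in>I. cinner (x i) y)"
  for y :: "'h::complex_inner"
  by (induction I rule: infinite_finite_induct) (simp_all add: cinner_add_left)

lemma cinner_sum_right: "cinner x (\<Sum>i\<in>I. y i) = (\<Sum>i\<in>I. cinner x (y i))"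
  for x :: "'h::complex_inner"
  by (induction I rule: infinite_finite_induct) (simp_all add: cinner_add_right)

lemmas cinner_simps = cinner_add_left cinner_add_right cinner_diff_left cinner_diff_right
  cinner_minus_left cinner_minus_right cinner_scaleC_left cinner_scaleC_right
  cinner_scaleR_left cinner_scaleR_right

lemma cinner_self: "cinner x x = complex_of_real ((norm x)\<^sup>2)" for x :: "'h::complex_inner"
proof (rule complex_eqI)
  show "Re (cinner x x) = Re (complex_of_real ((norm x)\<^sup>2))"
    using inner_eq_Re_cinner[of x x] by (simp add: power2_norm_eq_inner)
  show "Im (cinner x x) = Im (complex_of_real ((norm x)\<^sup>2))"
    using cinner_commute[of x x] by (simp add: complex_eq_iff)
qed

lemma cinner_self_eq_0 [simp]: "cinner x x = 0 \<longleftrightarrow> x = 0" for x :: "'h::complex_inner"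
  by (simp add: cinner_self)

lemma norm_scaleC: "norm (c *\<^sub>C x) = cmod c * norm x" for x :: "'h::complex_inner"
proof -
  have "cinner (c *\<^sub>C x) (c *\<^sub>C x) = (c * cnj c) * complex_of_real ((norm x)\<^sup>2)"
    by (simp only: cinner_scaleC_left cinner_scaleC_right cinner_self[of x] mult.assoc
        mult.left_commute[of "cnj c"])
  also have "\<dots> = complex_of_real ((cmod c * norm x)\<^sup>2)"
    by (simp only: power_mult_distrib of_real_mult complex_norm_square)
  finally have "cinner (c *\<^sub>C x) (c *\<^sub>C x) = complex_of_real ((cmod c * norm x)\<^sup>2)" .
  then have "(norm (c *\<^sub>C x))\<^sup>2 = (cmod c * norm x)\<^sup>2"
    by (simp only: cinner_self of_real_eq_iff)
  then show ?thesis by simp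
qed

text \<open>The Cauchy-Schwarz inequality inherited from the real structure only controls the real
  part. Multiplying \<open>x\<close> by the conjugate phase of \<open>cinner x y\<close> makes the
  product real and nonnegative without changing the norm of \<open>x\<close>.\<close>

lemma norm_cinner_le: "cmod (cinner x y) \<le> norm x * norm y" for x :: "'h::complex_inner"
proof (cases "cinner x y = 0")
  case False
  define c where "c = cnj (sgn (cinner x y))"
  have c: "cmod c = 1" using False by (simp add: c_def norm_sgn)
  have "c * cinner x y = (cinner x y * cnj (cinner x y)) / complex_of_real (cmod (cinner x y))"
    by (simp add: c_def sgn_eq)
  also have "\<dots> = complex_of_real (cmod (cinner x y))"
    using False by (simp add: power2_eq_square flip: complex_norm_square)
  finally have "c * cinner x y = complex_of_real (cmod (cinner x y))" .
  then have "cmod (cinner x y) = Re (cinner (c *\<^sub>C x) y)"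
    by (simp add: cinner_simps)
  also have "\<dots> \<le> norm (c *\<^sub>C x) * norm y"
    unfolding inner_eq_Re_cinner[symmetric] by (rule norm_cauchy_schwarz)
  finally show ?thesis by (simp add: norm_scaleC c)
qed auto

lemma bounded_linear_cinner_left: "bounded_linear (\<lambda>x. cinner x y)" for y :: "'h::complex_inner"
  by (rule bounded_linear_intro[of _ "norm y"])
    (simp_all add: cinner_simps scaleR_conv_of_real norm_cinner_le)

lemma bounded_linear_cinner_right: "bounded_linear (\<lambda>y. cinner x y)" for x :: "'h::complex_inner"
  by (rule bounded_linear_intro[of _ "norm x"])
    (simp_all add: cinner_simps scaleR_conv_of_real norm_cinner_le mult.commute[of "norm _" "norm x"])

text \<open>Equality case of Cauchy-Schwarz, by expanding the square of \<open>norm (x - y)\<close>.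
  It later recovers whole vectors of an operator from a single matrix entry.\<close>

lemma cinner_eq_unit_imp_eq:
  fixes x y :: "'h::complex_inner"
  assumes "norm x \<le> 1" "norm y = 1" "cinner x y = 1"
  shows "x = y"
proof -
  have "(norm (x - y))\<^sup>2 = (norm x)\<^sup>2 - 1"
  proof -
    have "cinner y x = 1" using assms(3) cinner_commute[of y x] by simp
    then have "cinner (x - y) (x - y) = complex_of_real ((norm x)\<^sup>2 - 1)"
      using assms by (simp add: cinner_diff_left cinner_diff_right cinner_self[of x] cinner_self[of y])
    then show ?thesis by (simp only: cinner_self of_real_eq_iff)
  qed
  moreover have "(norm x)\<^sup>2 \<le> 1" using assms(1) by (simp add: power_le_one)
  ultimately have "(norm (x - y))\<^sup>2 = 0" by (smt (verit) zero_le_power2)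
  then show ?thesis by simp
qed

section \<open>Orthonormal families and bases\<close>

text \<open>Indexed families rather than sets, because trace estimates pair \<open>x i\<close> with
  \<open>y i\<close>. A set of vectors is treated as the family
  \<open>\<lambda>e. e\<close>.\<close>

definition orthonormal_on :: "'i set \<Rightarrow> ('i \<Rightarrow> 'h::complex_inner) \<Rightarrow> bool"
  where "orthonormal_on I x \<longleftrightarrow> (\<forall>i\<in>I. \<forall>j\<in>I. cinner (x i) (x j) = (if i = j then 1 else 0))"

lemma orthonormal_onD:
  assumes "orthonormal_on I x" "i \<in> I" "j \<in> I"
  shows "cinner (x i) (x j) = (if i = j then 1 else 0)"
  using assms by (simp add: orthonormal_on_def)

lemma orthonormal_on_norm:
  assumes "orthonormal_on I x" "i \<in> I"
  shows "norm (x i) = 1"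
proof -
  have "complex_of_real ((norm (x i))\<^sup>2) = 1"
    using orthonormal_onD[OF assms assms(2)] by (simp add: cinner_self)
  then have "(norm (x i))\<^sup>2 = 1" by (simp only: of_real_eq_1_iff)
  then show ?thesis by (simp add: power2_eq_1_iff) (smt (verit) norm_ge_zero)
qed

lemma orthonormal_on_subset: "orthonormal_on I x \<Longrightarrow> J \<subseteq> I \<Longrightarrow> orthonormal_on J x"
  unfolding orthonormal_on_def by blast

lemma orthonormal_on_reindex:
  assumes "orthonormal_on I x" "inj_on g J" "g ` J \<subseteq> I"
  shows "orthonormal_on J (x \<circ> g)"
  unfolding orthonormal_on_def
proof (intro ballI)
  fix i j assume "i \<in> J" "j \<in> J"
  then show "cinner ((x \<circ> g) i) ((x \<circ> g) j) = (if i = j then 1 else 0)"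
    using orthonormal_onD[OF assms(1), of "g i" "g j"] assms(2,3) 
    by (simp add: inj_on_eq_iff image_subset_iff)
qed

lemma orthonormal_on_id:
  "orthonormal_on E (\<lambda>e. e) \<longleftrightarrow>
    (\<forall>e\<in>E. norm e = 1) \<and> (\<forall>e\<in>E. \<forall>f\<in>E. e \<noteq> f \<longrightarrow> cinner e f = 0)"
  using orthonormal_on_norm[of E "\<lambda>e. e"]
  by (auto simp: orthonormal_on_def cinner_self)

lemma orthonormal_basis_iff:
  "orthonormal_basis E \<longleftrightarrow>
    orthonormal_on E (\<lambda>e. e) \<and> (\<forall>x. (\<forall>e\<in>E. cinner x e = 0) \<longrightarrow> x = 0)"
  by (auto simp: orthonormal_basis_def orthonormal_on_id)

section \<open>Finite orthonormal sums and Bessel's inequality\<close>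

lemma norm_orthonormal_sum:
  assumes "finite I" "orthonormal_on I x"
  shows "(norm (\<Sum>i\<in>I. c i *\<^sub>C x i))\<^sup>2 = (\<Sum>i\<in>I. (cmod (c i))\<^sup>2)"
proof -
  have "cinner (\<Sum>i\<in>I. c i *\<^sub>C x i) (\<Sum>j\<in>I. c j *\<^sub>C x j)
      = (\<Sum>i\<in>I. \<Sum>j\<in>I. c i * (cnj (c j) * cinner (x i) (x j)))"
    unfolding cinner_sum_left by (simp add: cinner_sum_right cinner_simps sum_distrib_left mult.left_commute)
  also have "\<dots> = (\<Sum>i\<in>I. \<Sum>j\<in>I. if i = j then c i * cnj (c i) else 0)"
    by (intro sum.cong) (auto simp: orthonormal_onD[OF assms(2)])
  also have "\<dots> = (\<Sum>i\<in>I. complex_of_real ((cmod (c i))\<^sup>2))"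
    using assms(1) by (simp only: sum.delta' complex_norm_square) simp
  finally have "complex_of_real ((norm (\<Sum>i\<in>I. c i *\<^sub>C x i))\<^sup>2)
      = complex_of_real (\<Sum>i\<in>I. (cmod (c i))\<^sup>2)"
    by (simp add: cinner_self)
  then show ?thesis by (simp only: of_real_eq_iff)
qed

lemma cinner_orthonormal_sum:
  assumes "finite I" "orthonormal_on I x" "j \<in> I"
  shows "cinner (\<Sum>i\<in>I. c i *\<^sub>C x i) (x j) = c j"
proof -
  have "cinner (\<Sum>i\<in>I. c i *\<^sub>C x i) (x j) = (\<Sum>i\<in>I. if i = j then c i else 0)"
    unfolding cinner_sum_left
    by (intro sum.cong) (auto simp: cinner_simps orthonormal_onD[OF assms(2) _ assms(3)])
  then show ?thesis using assms by simp
qed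

lemma bessel_identity:
  assumes "finite I" "orthonormal_on I x"
  shows "(norm (z - (\<Sum>i\<in>I. cinner z (x i) *\<^sub>C x i)))\<^sup>2
    = (norm z)\<^sup>2 - (\<Sum>i\<in>I. (cmod (cinner z (x i)))\<^sup>2)"
proof -
  define p where "p = (\<Sum>i\<in>I. cinner z (x i) *\<^sub>C x i)"
  have "cinner z p = complex_of_real (\<Sum>i\<in>I. (cmod (cinner z (x i)))\<^sup>2)"
    unfolding p_def cinner_sum_right
    by (simp only: cinner_scaleC_right of_real_sum complex_norm_square mult.commute)
  moreover from this have "cinner p z = complex_of_real (\<Sum>i\<in>I. (cmod (cinner z (x i)))\<^sup>2)"
    by (subst cinner_commute) (simp only: complex_cnj_complex_of_real)
  moreover have "cinner p p = complex_of_real (\<Sum>i\<in>I. (cmod (cinner z (x i)))\<^sup>2)"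
    unfolding p_def cinner_self norm_orthonormal_sum[OF assms] ..
  ultimately have "cinner (z - p) (z - p)
      = complex_of_real ((norm z)\<^sup>2 - (\<Sum>i\<in>I. (cmod (cinner z (x i)))\<^sup>2))"
    by (simp only: cinner_diff_left cinner_diff_right cinner_self[of z] of_real_diff
        diff_self diff_zero)
  then show ?thesis unfolding p_def[symmetric] by (simp only: cinner_self of_real_eq_iff)
qed

lemma bessel_inequality:
  assumes "finite I" "orthonormal_on I x"
  shows "(\<Sum>i\<in>I. (cmod (cinner z (x i)))\<^sup>2) \<le> (norm z)\<^sup>2"
  using bessel_identity[OF assms, of z] by (smt (verit) zero_le_power2)

text \<open>Riesz-Fischer for an index set of any cardinality. By Pythagoras the distance between
  two nested partial sums is governed by a tail of the convergent sum of squares, so the net of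
  finite partial sums is Cauchy.\<close>

lemma orthonormal_summable_on:
  fixes E :: "'h::complex_hilbert_space set"
  assumes E: "orthonormal_on E (\<lambda>e. e)"
    and C: "\<And>F. finite F \<Longrightarrow> F \<subseteq> E \<Longrightarrow> (\<Sum>e\<in>F. (cmod (c e))\<^sup>2) \<le> C"
  shows "(\<lambda>e. c e *\<^sub>C e) summable_on E"
proof -
  let ?f = "\<lambda>e. c e *\<^sub>C e"
  have sq: "(\<lambda>e. (cmod (c e))\<^sup>2) summable_on E"
    by (rule nonneg_bounded_partial_sums_imp_summable_on[where C = C])
      (auto intro!: eventually_finite_subsets_at_top_weakI C)
  then obtain L where L: "(sum (\<lambda>e. (cmod (c e))\<^sup>2) \<longlongrightarrow> L) (finite_subsets_at_top E)"
    unfolding summable_on_def has_sum_def by blast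
  have "\<exists>P. eventually P (finite_subsets_at_top E) \<and>
      (\<forall>F F'. P F \<and> P F' \<longrightarrow> dist (sum ?f F) (sum ?f F') < r)" if "r > 0" for r
  proof -
    \<comment> \<open>Two sums of squares within \<open>(r/2)\<^sup>2 / 2\<close> of
      \<open>L\<close> differ by less than \<open>(r/2)\<^sup>2\<close>; the square root gives
      \<open>r/2\<close>, ready for the triangle inequality through \<open>F0\<close>.\<close>
    have "eventually (\<lambda>F. dist (sum (\<lambda>e. (cmod (c e))\<^sup>2) F) L < (r/2)\<^sup>2 / 2) (finite_subsets_at_top E)"
      by (rule tendstoD[OF L]) (use that in simp)
    then obtain F0 where F0: "finite F0" "F0 \<subseteq> E"
      and near: "\<And>F. finite F \<Longrightarrow> F0 \<subseteq> F \<Longrightarrow> F \<subseteq> E \<Longrightarrow>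
        dist (sum (\<lambda>e. (cmod (c e))\<^sup>2) F) L < (r/2)\<^sup>2 / 2"
      unfolding eventually_finite_subsets_at_top by meson
    have close: "dist (sum ?f F) (sum ?f F0) < r/2" if "finite F" "F0 \<subseteq> F" "F \<subseteq> E" for F
    proof -
      have "(dist (sum ?f F) (sum ?f F0))\<^sup>2 = (norm (sum ?f (F - F0)))\<^sup>2"
        using that by (simp add: dist_norm sum_diff)
      also have "\<dots> = (\<Sum>e\<in>F - F0. (cmod (c e))\<^sup>2)"
        using that by (intro norm_orthonormal_sum orthonormal_on_subset[OF E]) auto
      also have "\<dots> = sum (\<lambda>e. (cmod (c e))\<^sup>2) F - sum (\<lambda>e. (cmod (c e))\<^sup>2) F0"
        using that by (simp add: sum_diff)
      also have "\<dots> < (r/2)\<^sup>2"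
        using near[OF that] near[OF F0(1) order_refl F0(2)] unfolding dist_real_def by linarith
      finally show ?thesis using \<open>r > 0\<close> by (auto dest: power_less_imp_less_base)
    qed
    define P where "P F \<longleftrightarrow> finite F \<and> F0 \<subseteq> F \<and> F \<subseteq> E" for F
    have "eventually P (finite_subsets_at_top E)"
      unfolding eventually_finite_subsets_at_top P_def by (intro exI[of _ F0]) (use F0 in simp)
    moreover have "dist (sum ?f F) (sum ?f F') < r" if "P F" "P F'" for F F'
      using close[of F] close[of F'] that dist_triangle_half_l[of "sum ?f F" "sum ?f F0" r]
      unfolding P_def by blast
    ultimately show ?thesis by blast
  qed
  then have "cauchy_filter (filtermap (sum ?f) (finite_subsets_at_top E))"
    by (simp add: cauchy_filter_metric_filtermap)
  moreover have "complete (UNIV::'h set)"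
    by (meson Cauchy_convergent UNIV_I complete_def convergent_def)
  ultimately obtain l where "(sum ?f \<longlongrightarrow> l) (finite_subsets_at_top E)"
    using complete_uniform[where S=UNIV] by (force simp add: filterlim_def)
  then show ?thesis unfolding summable_on_def has_sum_def by blast
qed

lemma orthonormal_has_sum_coefficient:
  fixes E :: "'h::complex_hilbert_space set"
  assumes E: "orthonormal_on E (\<lambda>e. e)" and s: "((\<lambda>e. c e *\<^sub>C e) has_sum y) E" and "e \<in> E"
  shows "cinner y e = c e"
proof -
  have "((\<lambda>k. cinner (c k *\<^sub>C k) e) has_sum cinner y e) E"
    by (rule has_sum_bounded_linear[OF bounded_linear_cinner_left s])
  moreover have "((\<lambda>k. cinner (c k *\<^sub>C k) e) has_sum c e) E"
  proof (rule has_sum_finite_neutralI)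
    show "finite {e}" "{e} \<subseteq> E" using \<open>e \<in> E\<close> by auto
    show "c e = (\<Sum>k\<in>{e}. cinner (c k *\<^sub>C k) e)"
      using orthonormal_onD[OF E \<open>e \<in> E\<close> \<open>e \<in> E\<close>] by (simp add: cinner_simps)
    show "cinner (c k *\<^sub>C k) e = 0" if "k \<in> E - {e}" for k
      using orthonormal_onD[OF E _ \<open>e \<in> E\<close>, of k] that by (simp add: cinner_simps)
  qed
  ultimately show ?thesis by (rule has_sum_unique)
qed

lemma basis_expansion:
  fixes E :: "'h::complex_hilbert_space set"
  assumes "orthonormal_basis E"
  shows "((\<lambda>e. cinner x e *\<^sub>C e) has_sum x) E"
proof -
  have E: "orthonormal_on E (\<lambda>e. e)" and total: "\<And>x. (\<forall>e\<in>E. cinner x e = 0) \<Longrightarrow> x = 0"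
    using assms by (auto simp: orthonormal_basis_iff)
  have "(\<lambda>e. cinner x e *\<^sub>C e) summable_on E"
    by (rule orthonormal_summable_on[OF E, of _ "(norm x)\<^sup>2"])
      (rule bessel_inequality[OF _ orthonormal_on_subset[OF E]])
  then obtain y where y: "((\<lambda>e. cinner x e *\<^sub>C e) has_sum y) E"
    unfolding summable_on_def by blast
  have "\<forall>e\<in>E. cinner (x - y) e = 0"
    using orthonormal_has_sum_coefficient[OF E y] by (simp add: cinner_simps)
  then have "x = y" using total[of "x - y"] by simp
  then show ?thesis using y by simp
qed

lemma parseval:
  fixes E :: "'h::complex_hilbert_space set"
  assumes "orthonormal_basis E"
  shows "((\<lambda>e. cinner x e * cinner e y) has_sum cinner x y) E"
  using has_sum_bounded_linear[OF bounded_linear_cinner_left basis_expansion[OF assms]]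
  by (simp add: cinner_simps)

lemma parseval_norm:
  fixes E :: "'h::complex_hilbert_space set"
  assumes "orthonormal_basis E"
  shows "((\<lambda>e. (cmod (cinner x e))\<^sup>2) has_sum (norm x)\<^sup>2) E"
proof -
  have "((\<lambda>e. Re (cinner x e * cinner e x)) has_sum Re (cinner x x)) E"
    by (rule has_sum_Re[OF parseval[OF assms]])
  moreover have "Re (cinner x e * cinner e x) = (cmod (cinner x e))\<^sup>2" for e
    unfolding cinner_commute[of e x] complex_norm_square[symmetric] by (rule Re_complex_of_real)
  ultimately show ?thesis by (simp add: cinner_self)
qed

text \<open>Zorn's lemma among orthonormal subsets of a set \<open>Q\<close> of admissible vectors.
  With \<open>Q = UNIV\<close> this yields an ordinary basis, and with \<open>Q\<close> the
  eigenvectors of \<open>a\<^sup>* a\<close> a diagonalisation; only \<open>step\<close> has to be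
  checked anew.\<close>

lemma extend_to_orthonormal_basis:
  fixes E0 :: "'h::complex_hilbert_space set"
  assumes E0: "orthonormal_on E0 (\<lambda>e. e)" "E0 \<subseteq> Q"
    and step: "\<And>E x. orthonormal_on E (\<lambda>e. e) \<Longrightarrow> E \<subseteq> Q \<Longrightarrow> x \<noteq> 0 \<Longrightarrow> \<forall>e\<in>E. cinner x e = 0 \<Longrightarrow>
      \<exists>q\<in>Q. norm q = 1 \<and> (\<forall>e\<in>E. cinner q e = 0)"
  shows "\<exists>E. orthonormal_basis E \<and> E0 \<subseteq> E \<and> E \<subseteq> Q"
proof -
  define A where "A = {E. orthonormal_on E (\<lambda>e. e) \<and> E0 \<subseteq> E \<and> E \<subseteq> Q}"
  have "A \<noteq> {}" using E0 by (auto simp: A_def)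
  moreover have "\<Union>C \<in> A" if "C \<noteq> {}" "subset.chain A C" for C
  proof -
    have CA: "C \<subseteq> A" and ch: "\<And>X Y. X \<in> C \<Longrightarrow> Y \<in> C \<Longrightarrow> X \<subseteq> Y \<or> Y \<subseteq> X"
      using that(2) by (auto simp: subset_chain_def)
    have "cinner e f = (if e = f then 1 else 0)" if ef: "e \<in> \<Union>C" "f \<in> \<Union>C" for e f
    proof -
      obtain X where "X \<in> C" "e \<in> X" "f \<in> X" using ef ch by (metis UnionE subsetD)
      then show ?thesis using CA orthonormal_onD[of X "\<lambda>e. e" e f] by (auto simp: A_def)
    qed
    then have "orthonormal_on (\<Union>C) (\<lambda>e. e)" by (simp add: orthonormal_on_def)
    moreover have "E0 \<subseteq> \<Union>C" "\<Union>C \<subseteq> Q" using that(1) CA by (auto simp: A_def)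
    ultimately show ?thesis by (simp add: A_def)
  qed
  ultimately obtain M where M: "M \<in> A" "\<And>X. X \<in> A \<Longrightarrow> M \<subseteq> X \<Longrightarrow> X = M"
    using subset_Zorn_nonempty[of A] by blast
  then have MA: "orthonormal_on M (\<lambda>e. e)" "E0 \<subseteq> M" "M \<subseteq> Q" by (auto simp: A_def)
  have "x = 0" if x: "\<forall>e\<in>M. cinner x e = 0" for x
  proof (rule ccontr)
    assume "x \<noteq> 0"
    then obtain q where q: "q \<in> Q" "norm q = 1" "\<forall>e\<in>M. cinner q e = 0"
      using step[OF MA(1) MA(3) _ x] by blast
    have "cinner e q = 0" if "e \<in> M" for e using q(3) that cinner_commute[of e q] by simp
    then have "orthonormal_on (insert q M) (\<lambda>e. e)"
      using MA(1) q by (auto simp: orthonormal_on_id)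
    then have "insert q M \<in> A" using q MA by (auto simp: A_def)
    then have "insert q M = M" by (rule M(2)) auto
    then have "q \<in> M" by blast
    then have "cinner q q = 0" using q(3) by blast
    then show False using q(2) by simp
  qed
  then show ?thesis using MA by (auto simp: orthonormal_basis_iff)
qed

lemma orthonormal_basis_exists: "\<exists>E :: 'h::complex_hilbert_space set. orthonormal_basis E"
proof -
  have "\<exists>q\<in>UNIV. norm q = 1 \<and> (\<forall>e\<in>E. cinner q e = 0)"
    if "x \<noteq> 0" "\<forall>e\<in>E. cinner x e = 0" for E and x :: 'h
    using that by (intro bexI[of _ "inverse (norm x) *\<^sub>R x"]) (auto simp: cinner_simps)
  then have "\<exists>E :: 'h set. orthonormal_basis E \<and> {} \<subseteq> E \<and> E \<subseteq> UNIV"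
    by (intro extend_to_orthonormal_basis) (simp_all add: orthonormal_on_def)
  then show ?thesis by blast
qed


section \<open>Bounded operators\<close>

lemma bounded_operators_scaleC:
  "a \<in> bounded_operators \<Longrightarrow> blinfun_apply a (c *\<^sub>C x) = c *\<^sub>C blinfun_apply a x"
  by (simp add: bounded_operators_def)

section \<open>Riesz representation and adjoints\<close>

lemma cinner_extensionality:
  fixes u w :: "'h::complex_inner"
  assumes "\<And>x. cinner x u = cinner x w"
  shows "u = w"
proof -
  have "cinner (u - w) (u - w) = 0" using assms by (simp add: cinner_diff_right)
  then show ?thesis by simp
qed

text \<open>The representing vector is written down in a basis, with coefficients
  \<open>cnj (f e)\<close>. Testing \<open>f\<close> on the finite partial sums \<open>z\<close>
  gives \<open>(norm z)\<^sup>2 = f z \<le> K * norm z\<close>, hence the uniform bound that makes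
  the series converge.\<close>

lemma riesz_representation:
  fixes f :: "'h::complex_hilbert_space \<Rightarrow> complex"
  assumes f: "bounded_linear f" and fC: "\<And>c x. f (c *\<^sub>C x) = c * f x"
  shows "\<exists>y. \<forall>x. f x = cinner x y"
proof -
  interpret bounded_linear f by (fact f)
  obtain E :: "'h set" where E: "orthonormal_basis E" using orthonormal_basis_exists by blast
  then have on: "orthonormal_on E (\<lambda>e. e)" by (simp add: orthonormal_basis_iff)
  obtain K where K: "K \<ge> 0" "\<And>x. norm (f x) \<le> norm x * K" using nonneg_bounded by blast
  have "(\<lambda>e. cnj (f e) *\<^sub>C e) summable_on E"
  proof (rule orthonormal_summable_on[OF on, of _ "K\<^sup>2"])
    fix F assume F: "finite F" "F \<subseteq> E"
    define z where "z = (\<Sum>e\<in>F. cnj (f e) *\<^sub>C e)"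
    define S where "S = (\<Sum>e\<in>F. (cmod (f e))\<^sup>2)"
    have S0: "S \<ge> 0" unfolding S_def by (simp add: sum_nonneg)
    have nz: "(norm z)\<^sup>2 = S"
      unfolding z_def S_def using norm_orthonormal_sum[OF F(1) orthonormal_on_subset[OF on F(2)]]
      by simp
    have "f z = (\<Sum>e\<in>F. complex_of_real ((cmod (f e))\<^sup>2))"
      unfolding z_def sum fC by (simp only: complex_norm_square mult.commute)
    then have "f z = complex_of_real S" by (simp add: S_def)
    then have "S \<le> norm z * K" using K(2)[of z] S0 by simp
    then have "norm z * norm z \<le> norm z * K" using nz by (simp add: power2_eq_square)
    then have "norm z \<le> K" using K(1) by (cases "norm z = 0") auto
    then have "S \<le> K\<^sup>2" using nz power_mono[of "norm z" K 2] by simp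
    then show "(\<Sum>e\<in>F. (cmod (cnj (f e)))\<^sup>2) \<le> K\<^sup>2" by (simp add: S_def)
  qed
  then obtain y where y: "((\<lambda>e. cnj (f e) *\<^sub>C e) has_sum y) E" unfolding summable_on_def by blast
  have "f x = cinner x y" for x
  proof -
    have "((\<lambda>e. cinner x e * f e) has_sum f x) E"
      using has_sum_bounded_linear[OF f basis_expansion[OF E, of x]] by (simp add: fC)
    moreover have "((\<lambda>e. cinner x e * f e) has_sum cinner x y) E"
      using has_sum_bounded_linear[OF bounded_linear_cinner_right y, of x]
      by (simp add: cinner_scaleC_right mult.commute)
    ultimately show ?thesis by (rule has_sum_unique)
  qed
  then show ?thesis by blast
qed

lemma adjoint_exists:
  assumes a: "a \<in> bounded_operators"
  shows "\<exists>b\<in>bounded_operators. \<forall>x y. cinner (blinfun_apply a x) y = cinner x (blinfun_apply b y)"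
proof -
  have "\<exists>w. \<forall>x. cinner (blinfun_apply a x) y = cinner x w" for y
  proof (rule riesz_representation)
    show "bounded_linear (\<lambda>x. cinner (blinfun_apply a x) y)"
      by (rule bounded_linear_compose[OF bounded_linear_cinner_left blinfun.bounded_linear_right])
  qed (simp add: bounded_operators_scaleC[OF a] cinner_scaleC_left)
  then obtain g where g: "\<And>x y. cinner (blinfun_apply a x) y = cinner x (g y)" by metis
  have gC: "g (c *\<^sub>C y) = c *\<^sub>C g y" for c y
    by (rule cinner_extensionality) (simp add: cinner_scaleC_right flip: g)
  have bl: "bounded_linear g"
  proof (rule bounded_linear_intro[of _ "norm a"])
    show "g (x + y) = g x + g y" for x y
      by (rule cinner_extensionality) (simp add: cinner_add_right flip: g)
    show "g (r *\<^sub>R x) = r *\<^sub>R g x" for r x by (simp add: scaleR_eq_scaleC gC)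
    show "norm (g y) \<le> norm y * norm a" for y
    proof (cases "g y = 0")
      case False
      have "complex_of_real ((norm (g y))\<^sup>2) = cinner (blinfun_apply a (g y)) y"
        by (simp only: g cinner_self)
      then have "(norm (g y))\<^sup>2 = cmod (cinner (blinfun_apply a (g y)) y)"
        by (metis abs_power2 norm_of_real)
      also have "\<dots> \<le> norm (blinfun_apply a (g y)) * norm y" by (rule norm_cinner_le)
      also have "\<dots> \<le> (norm a * norm (g y)) * norm y"
        by (intro mult_right_mono norm_blinfun) simp
      finally have "norm (g y) * norm (g y) \<le> norm (g y) * (norm y * norm a)"
        by (simp add: power2_eq_square mult_ac)
      then show ?thesis using False by simp
    qed simp
  qed
  have app: "blinfun_apply (Blinfun g) = g" by (rule bounded_linear_Blinfun_apply[OF bl])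
  show ?thesis
    by (rule bexI[of _ "Blinfun g"]) (simp_all add: app g bounded_operators_def gC)
qed

lemma cadjoint:
  assumes a: "a \<in> bounded_operators"
  shows cadjoint_bounded: "cadjoint a \<in> bounded_operators"
    and cinner_cadjoint: "cinner (blinfun_apply a x) y = cinner x (blinfun_apply (cadjoint a) y)"
proof -
  define P where "P = (\<lambda>b. b \<in> bounded_operators \<and>
    (\<forall>x y. cinner (blinfun_apply a x) y = cinner x (blinfun_apply b y)))"
  have "Ex P" using adjoint_exists[OF a] unfolding P_def by blast
  then obtain b where b: "P b" ..
  have "b' = b" if b': "P b'" for b'
  proof (rule blinfun_eqI, rule cinner_extensionality)
    fix y x
    have "cinner x (blinfun_apply b' y) = cinner (blinfun_apply a x) y" using b' by (simp add: P_def)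
    also have "\<dots> = cinner x (blinfun_apply b y)" using b by (simp add: P_def)
    finally show "cinner x (blinfun_apply b' y) = cinner x (blinfun_apply b y)" .
  qed
  then have "(THE b. P b) = b" using b by (intro the_equality)
  then have "cadjoint a = b" unfolding cadjoint_def P_def .
  then have "P (cadjoint a)" using b by simp
  then show "cadjoint a \<in> bounded_operators"
    and "cinner (blinfun_apply a x) y = cinner x (blinfun_apply (cadjoint a) y)"
    by (simp_all add: P_def)
qed

lemma cinner_cadjoint_left:
  assumes "a \<in> bounded_operators"
  shows "cinner (blinfun_apply (cadjoint a) y) x = cinner y (blinfun_apply a x)"
  using cinner_cadjoint[OF assms, of x y] by (metis cinner_commute)

lemma norm_cadjoint_le:
  assumes a: "a \<in> bounded_operators"
  shows "norm (cadjoint a) \<le> norm a"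
proof (rule norm_blinfun_bound)
  fix y
  let ?w = "blinfun_apply (cadjoint a) y"
  have "complex_of_real ((norm ?w)\<^sup>2) = cinner (blinfun_apply a ?w) y"
    by (simp only: cinner_cadjoint[OF a] cinner_self)
  then have "(norm ?w)\<^sup>2 = cmod (cinner (blinfun_apply a ?w) y)" by (metis abs_power2 norm_of_real)
  also have "\<dots> \<le> (norm a * norm ?w) * norm y"
    by (rule order_trans[OF norm_cinner_le]) (intro mult_right_mono norm_blinfun, simp)
  finally have "norm ?w * norm ?w \<le> norm ?w * (norm a * norm y)"
    by (simp add: power2_eq_square mult_ac)
  then show "norm ?w \<le> norm a * norm y" by (cases "norm ?w = 0") auto
qed simp

lemma operator_expansion:
  assumes "a \<in> bounded_operators" "orthonormal_basis E"
  shows "((\<lambda>e. cinner x e *\<^sub>C blinfun_apply a e) has_sum blinfun_apply a x) E"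
  using has_sum_bounded_linear[OF blinfun.bounded_linear_right[of a] basis_expansion[OF assms(2), of x]]
  by (simp add: bounded_operators_scaleC[OF assms(1)])

lemma operator_eqI:
  assumes "a \<in> bounded_operators" "b \<in> bounded_operators" "orthonormal_basis E"
    and "\<And>e. e \<in> E \<Longrightarrow> blinfun_apply a e = blinfun_apply b e"
  shows "a = b"
proof (rule blinfun_eqI)
  fix x
  have "((\<lambda>e. cinner x e *\<^sub>C blinfun_apply b e) has_sum blinfun_apply a x) E"
    using operator_expansion[OF assms(1,3), of x] assms(4)
    by (simp cong: has_sum_cong)
  then show "blinfun_apply a x = blinfun_apply b x"
    using operator_expansion[OF assms(2,3), of x] by (rule has_sum_unique)
qed

lemma bounded_operators_compose:
  "a \<in> bounded_operators \<Longrightarrow> b \<in> bounded_operators \<Longrightarrow> a o\<^sub>L b \<in> bounded_operators"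
  by (simp add: bounded_operators_def)

text \<open>Supplies an explicit candidate for \<open>abs_operator a\<close>: later
  \<open>s e\<close> is the singular value \<open>norm (a e)\<close>. Multiplying coefficients by
  bounded numbers preserves square summability, and positivity is visible term by term.\<close>

lemma diagonal_operator_exists:
  fixes E :: "'h::complex_hilbert_space set"
  assumes E: "orthonormal_basis E" and s: "\<And>e. e \<in> E \<Longrightarrow> 0 \<le> s e \<and> s e \<le> C"
  shows "\<exists>d. positive_operator d \<and> (\<forall>e\<in>E. blinfun_apply d e = s e *\<^sub>R e)"
proof -
  have on: "orthonormal_on E (\<lambda>e. e)" using E by (simp add: orthonormal_basis_iff)
  define c where "c x e = complex_of_real (s e) * cinner x e" for x e
  have c_le: "(cmod (c x e))\<^sup>2 \<le> C\<^sup>2 * (cmod (cinner x e))\<^sup>2" if "e \<in> E" for x e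
    using s[OF that] by (simp add: c_def norm_mult power_mult_distrib mult_right_mono power_mono)
  have "(\<lambda>e. c x e *\<^sub>C e) summable_on E" for x
  proof (rule orthonormal_summable_on[OF on, of _ "C\<^sup>2 * (norm x)\<^sup>2"])
    fix F assume F: "finite F" "F \<subseteq> E"
    have "(\<Sum>e\<in>F. (cmod (c x e))\<^sup>2) \<le> C\<^sup>2 * (\<Sum>e\<in>F. (cmod (cinner x e))\<^sup>2)"
      unfolding sum_distrib_left using F by (intro sum_mono c_le) auto
    also have "\<dots> \<le> C\<^sup>2 * (norm x)\<^sup>2"
      by (intro mult_left_mono bessel_inequality[OF F(1) orthonormal_on_subset[OF on F(2)]]) simp
    finally show "(\<Sum>e\<in>F. (cmod (c x e))\<^sup>2) \<le> C\<^sup>2 * (norm x)\<^sup>2" .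
  qed
  then obtain g where g: "\<And>x. ((\<lambda>e. c x e *\<^sub>C e) has_sum g x) E"
    unfolding summable_on_def by metis
  have gC: "g (t *\<^sub>C x) = t *\<^sub>C g x" for t x
  proof (rule has_sum_unique[OF g])
    have "bounded_linear (\<lambda>x::'h. t *\<^sub>C x)"
      by (rule bounded_linear_intro[of _ "cmod t"])
        (simp_all add: scaleC_add_right norm_scaleC scaleR_eq_scaleC scaleC_scaleC mult.commute)
    from has_sum_bounded_linear[OF this g[of x]]
    show "((\<lambda>e. c (t *\<^sub>C x) e *\<^sub>C e) has_sum t *\<^sub>C g x) E"
      by (simp add: scaleC_scaleC c_def cinner_scaleC_left mult.left_commute)
  qed
  have bl: "bounded_linear g"
  proof (rule bounded_linear_intro[of _ "\<bar>C\<bar>"])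
    show "g (x + y) = g x + g y" for x y
      using has_sum_add[OF g[of x] g[of y]]
      by (intro has_sum_unique[OF g]) (simp add: c_def cinner_add_left algebra_simps scaleC_add_left)
    show "g (r *\<^sub>R x) = r *\<^sub>R g x" for r x by (simp add: scaleR_eq_scaleC gC)
    show "norm (g x) \<le> norm x * \<bar>C\<bar>" for x
    proof -
      have "(norm (g x))\<^sup>2 \<le> C\<^sup>2 * (norm x)\<^sup>2"
      proof (rule has_sum_mono)
        show "((\<lambda>e. (cmod (cinner (g x) e))\<^sup>2) has_sum (norm (g x))\<^sup>2) E"
          by (rule parseval_norm[OF E])
        show "((\<lambda>e. C\<^sup>2 * (cmod (cinner x e))\<^sup>2) has_sum C\<^sup>2 * (norm x)\<^sup>2) E"
          by (rule has_sum_cmult_right[OF parseval_norm[OF E]])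
        show "(cmod (cinner (g x) e))\<^sup>2 \<le> C\<^sup>2 * (cmod (cinner x e))\<^sup>2" if "e \<in> E" for e
          using c_le[OF that] orthonormal_has_sum_coefficient[OF on g that] by simp
      qed
      then have "(norm (g x))\<^sup>2 \<le> (norm x * \<bar>C\<bar>)\<^sup>2" by (simp add: power_mult_distrib mult.commute)
      then show ?thesis by (rule power2_le_imp_le) simp
    qed
  qed
  have app: "blinfun_apply (Blinfun g) = g" by (rule bounded_linear_Blinfun_apply[OF bl])
  have "g e = s e *\<^sub>R e" if "e \<in> E" for e
  proof (rule has_sum_unique[OF g], rule has_sum_finite_neutralI)
    show "finite {e}" "{e} \<subseteq> E" using that by auto
    show "s e *\<^sub>R e = (\<Sum>k\<in>{e}. c e k *\<^sub>C k)"
      using orthonormal_onD[OF on that that] by (simp add: c_def scaleR_eq_scaleC)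
    show "c e k *\<^sub>C k = 0" if "k \<in> E - {e}" for k
      using orthonormal_onD[OF on \<open>e \<in> E\<close>, of k] that by (auto simp: c_def)
  qed
  moreover have "cinner (g x) x \<in> \<real>\<^sub>\<ge>\<^sub>0" for x
  proof -
    have "c x e * cinner e x = complex_of_real (s e * (cmod (cinner x e))\<^sup>2)" for e
      unfolding c_def cinner_commute[of e x] of_real_mult complex_norm_square by (rule mult.assoc)
    then have *: "((\<lambda>e. complex_of_real (s e * (cmod (cinner x e))\<^sup>2)) has_sum cinner (g x) x) E"
      using has_sum_bounded_linear[OF bounded_linear_cinner_left g[of x], of x]
      by (simp only: cinner_scaleC_left)
    have "Re (cinner (g x) x) \<ge> 0"
      by (rule has_sum_nonneg[OF has_sum_Re[OF *]]) (use s in simp)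
    moreover have "((\<lambda>e. 0) has_sum Im (cinner (g x) x)) E"
      using has_sum_Im[OF *] by simp
    then have "Im (cinner (g x) x) = 0" by (rule has_sum_unique) simp
    ultimately show ?thesis by (simp add: complex_nonneg_Reals_iff)
  qed
  ultimately show ?thesis
    by (intro exI[of _ "Blinfun g"])
      (simp add: positive_operator_def app bounded_operators_def gC)
qed

text \<open>The source of uniqueness of positive square roots. From
  \<open>(s + l) (s - l) x = 0\<close>, the vector \<open>y = (s - l) x\<close> satisfies
  \<open>s y = - l y\<close>, which positivity forbids for \<open>l > 0\<close> unless
  \<open>y = 0\<close>.\<close>

lemma positive_operator_sqrt_eigenvector:
  assumes s: "positive_operator s" and l: "l \<ge> 0"
    and x: "blinfun_apply s (blinfun_apply s x) = l\<^sup>2 *\<^sub>R x"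
  shows "blinfun_apply s x = l *\<^sub>R x"
proof -
  have sB: "s \<in> bounded_operators" and pos: "\<And>x. Re (cinner (blinfun_apply s x) x) \<ge> 0"
    using s by (auto simp: positive_operator_def complex_nonneg_Reals_iff)
  define y where "y = blinfun_apply s x - l *\<^sub>R x"
  show ?thesis
  proof (cases "l = 0")
    case False
    have "blinfun_apply s y = - l *\<^sub>R y"
      by (simp add: y_def x blinfun.diff_right blinfun.scaleR_right power2_eq_square algebra_simps)
    then have "- l * (norm y)\<^sup>2 \<ge> 0"
      using pos[of y] by (simp add: cinner_simps cinner_self)
    then have "(norm y)\<^sup>2 \<le> 0" using l False by (simp add: mult_le_0_iff)
    then show ?thesis by (simp add: y_def)
  next
    case True
    then have y: "blinfun_apply s x = y" "blinfun_apply s y = 0" using x by (auto simp: y_def)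
    \<comment> \<open>Without self-adjointness of \<open>s\<close> at hand: positivity at \<open>x - t y\<close> for all real \<open>t\<close>.\<close>
    have "t * (norm y)\<^sup>2 \<le> Re (cinner y x)" for t :: real
      using pos[of "x - t *\<^sub>R y"]
      by (simp add: blinfun.diff_right blinfun.scaleR_right y cinner_simps cinner_self)
    \<comment> \<open>For \<open>y \<noteq> 0\<close> this value of \<open>t\<close> turns the
      inequality into \<open>Re (cinner y x) + 1 \<le> Re (cinner y x)\<close>.\<close>
    from this[of "(Re (cinner y x) + 1) / (norm y)\<^sup>2"] have "y = 0" by (cases "y = 0") auto
    then show ?thesis using y True by simp
  qed
qed

section \<open>Singular bases of compact operators\<close>

text \<open>A complete set of right singular vectors: the singular values are the numbers
  \<open>norm (a e)\<close>. Kernel vectors belong to the basis too, so sums over \<open>E\<close>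
  need no separate kernel part.\<close>

definition singular_basis :: "('h::complex_hilbert_space \<Rightarrow>\<^sub>L 'h) \<Rightarrow> 'h set \<Rightarrow> bool"
  where "singular_basis a E \<longleftrightarrow> orthonormal_basis E \<and>
    (\<forall>e\<in>E. \<forall>f\<in>E. e \<noteq> f \<longrightarrow> cinner (blinfun_apply a e) (blinfun_apply a f) = 0)"

lemma singular_basis_eigenvector:
  assumes a: "a \<in> bounded_operators" and E: "singular_basis a E" and e: "e \<in> E"
  shows "blinfun_apply (cadjoint a) (blinfun_apply a e) = (norm (blinfun_apply a e))\<^sup>2 *\<^sub>R e"
proof -
  let ?d = "blinfun_apply (cadjoint a) (blinfun_apply a e) - (norm (blinfun_apply a e))\<^sup>2 *\<^sub>R e"
  have on: "orthonormal_on E (\<lambda>e. e)" and total: "\<And>x. (\<forall>e\<in>E. cinner x e = 0) \<Longrightarrow> x = 0"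
    using E by (auto simp: singular_basis_def orthonormal_basis_iff)
  have "cinner ?d f = 0" if f: "f \<in> E" for f
  proof (cases "e = f")
    case True
    then show ?thesis using orthonormal_onD[OF on f f]
      by (simp add: cinner_diff_left cinner_cadjoint_left[OF a] cinner_scaleR_left
          cinner_self[of "blinfun_apply a f"])
  next
    case False
    then show ?thesis using orthonormal_onD[OF on e f] E e f
      by (simp add: cinner_diff_left cinner_cadjoint_left[OF a] cinner_scaleR_left singular_basis_def)
  qed
  then show ?thesis using total[of ?d] by simp
qed

text \<open>The diagonal operator with the singular values as entries is a positive square root of
  \<open>a\<^sup>* a\<close>. Any other one agrees with it on every eigenvector
  \<open>e \<in> E\<close>, so the description by \<open>THE\<close> determines it.\<close>

lemma abs_operator_singular_basis:
  assumes a: "a \<in> bounded_operators" and E: "singular_basis a E"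
  shows "abs_operator a \<in> bounded_operators"
    and "e \<in> E \<Longrightarrow> blinfun_apply (abs_operator a) e = norm (blinfun_apply a e) *\<^sub>R e"
proof -
  let ?n = "\<lambda>e. norm (blinfun_apply a e)"
  have basis: "orthonormal_basis E" using E by (simp add: singular_basis_def)
  define P where "P = (\<lambda>s. positive_operator s \<and> s o\<^sub>L s = cadjoint a o\<^sub>L a)"
  have "?n e \<le> norm a" if "e \<in> E" for e
    using norm_blinfun[of a e] basis that by (simp add: orthonormal_basis_def)
  then have "\<exists>d. positive_operator d \<and> (\<forall>e\<in>E. blinfun_apply d e = ?n e *\<^sub>R e)"
    by (intro diagonal_operator_exists[OF basis, of _ "norm a"]) simp
  then obtain d where d: "positive_operator d" "\<And>e. e \<in> E \<Longrightarrow> blinfun_apply d e = ?n e *\<^sub>R e"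
    by blast
  have dB: "d \<in> bounded_operators" using d by (simp add: positive_operator_def)
  have "d o\<^sub>L d = cadjoint a o\<^sub>L a"
    using d(2) singular_basis_eigenvector[OF a E]
    by (intro operator_eqI[OF _ _ basis] bounded_operators_compose dB a cadjoint_bounded)
      (simp add: blinfun.scaleR_right power2_eq_square)
  then have Pd: "P d" using d(1) by (simp add: P_def)
  have "s = d" if "P s" for s
  proof (rule operator_eqI[OF _ dB basis])
    have s: "positive_operator s" "s o\<^sub>L s = cadjoint a o\<^sub>L a" using that by (auto simp: P_def)
    then show "s \<in> bounded_operators" by (simp add: positive_operator_def)
    fix e assume e: "e \<in> E"
    have "blinfun_apply s (blinfun_apply s e) = (?n e)\<^sup>2 *\<^sub>R e"
      using singular_basis_eigenvector[OF a E e] arg_cong[OF s(2), of "\<lambda>b. blinfun_apply b e"] by simp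
    then show "blinfun_apply s e = blinfun_apply d e"
      using positive_operator_sqrt_eigenvector[OF s(1) norm_ge_zero] d(2)[OF e] by metis
  qed
  then have "(THE s. P s) = d" using Pd by (intro the_equality)
  then have "abs_operator a = d" unfolding abs_operator_def sqrt_operator_def P_def .
  then show "abs_operator a \<in> bounded_operators"
    and "e \<in> E \<Longrightarrow> blinfun_apply (abs_operator a) e = ?n e *\<^sub>R e"
    using dB d(2) by auto
qed

text \<open>
  A maximising sequence for \<open>norm (a x)\<close> on the unit sphere of an invariant subspace is an
  approximate eigenvector sequence of \<open>a\<^sup>* a\<close>; compactness makes a subsequence converge.
\<close>

lemma maximal_eigenvector:
  fixes a :: "'h::complex_hilbert_space \<Rightarrow>\<^sub>L 'h"
  assumes "compact_operator a"
    and M: "closed M" "\<And>r x. x \<in> M \<Longrightarrow> r *\<^sub>R x \<in> M"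
    and inv: "\<And>x. x \<in> M \<Longrightarrow> blinfun_apply (cadjoint a) (blinfun_apply a x) \<in> M"
    and x0: "x0 \<in> M" "x0 \<noteq> 0"
  shows "\<exists>q\<in>M. norm q = 1 \<and>
    blinfun_apply (cadjoint a) (blinfun_apply a q) = (norm (blinfun_apply a q))\<^sup>2 *\<^sub>R q \<and>
    (\<forall>x\<in>M. norm (blinfun_apply a x) \<le> norm (blinfun_apply a q) * norm x)"
proof -
  have a: "a \<in> bounded_operators" using assms(1) by (simp add: compact_operator_def)
  define p where "p = blinfun_apply (cadjoint a) \<circ> blinfun_apply a"
  have inner_p: "inner (p x) y = inner (blinfun_apply a x) (blinfun_apply a y)" for x y
    by (simp add: inner_eq_Re_cinner p_def cinner_cadjoint_left[OF a])
  define S where "S = {x \<in> M. norm x = 1}"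
  have unit: "inverse (norm x) *\<^sub>R x \<in> S" if "x \<in> M" "x \<noteq> 0" for x
    using that M(2) by (simp add: S_def)
  define \<sigma> where "\<sigma> = (SUP x\<in>S. norm (blinfun_apply a x))"
  have bdd: "bdd_above ((\<lambda>x. norm (blinfun_apply a x)) ` S)"
    by (rule bdd_aboveI[of _ "norm a"]) (use norm_blinfun[of a] in \<open>auto simp: S_def\<close>, metis mult.right_neutral)
  have Sne: "S \<noteq> {}" using unit[OF x0] by blast
  have \<sigma>: "norm (blinfun_apply a x) \<le> \<sigma> * norm x" if "x \<in> M" for x
  proof (cases "x = 0")
    case False
    have "norm (blinfun_apply a (inverse (norm x) *\<^sub>R x)) \<le> \<sigma>"
      unfolding \<sigma>_def by (rule cSUP_upper[OF unit[OF that False] bdd])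
    then show ?thesis using False by (simp add: blinfun.scaleR_right field_simps)
  qed simp
  have \<sigma>0: "\<sigma> \<ge> 0"
    using \<sigma>[OF x0(1)] x0(2) norm_ge_zero[of "blinfun_apply a x0"]
    by (smt (verit) mult_neg_pos zero_less_norm_iff)
  show ?thesis
  proof (cases "\<sigma> = 0")
    case True
    obtain q where q: "q \<in> S" using Sne by blast
    then have "blinfun_apply a q = 0" using \<sigma>[of q] True by (simp add: S_def)
    then show ?thesis using q \<sigma> True by (intro bexI[of _ q]) (auto simp: S_def)
  next
    case False
    have "\<exists>x\<in>S. \<sigma> - inverse (Suc n) < norm (blinfun_apply a x)" for n
      using less_cSUP_iff[OF Sne bdd, of "\<sigma> - inverse (Suc n)"] by (simp flip: \<sigma>_def)
    then obtain X where X: "\<And>n. X n \<in> S" "\<And>n. \<sigma> - inverse (Suc n) < norm (blinfun_apply a (X n))"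
      by metis
    have XM: "X n \<in> M" and X1: "norm (X n) = 1" for n using X(1)[of n] by (auto simp: S_def)
    have "compact (closure (blinfun_apply a ` cball 0 1))"
      using assms(1) by (simp add: compact_operator_def)
    moreover have "blinfun_apply a (X n) \<in> closure (blinfun_apply a ` cball 0 1)" for n
      using X1[of n] by (intro subsetD[OF closure_subset] imageI) simp
    ultimately obtain z r where r: "strict_mono (r :: nat \<Rightarrow> nat)"
      and z: "((\<lambda>n. blinfun_apply a (X n)) \<circ> r) \<longlonglongrightarrow> z"
      unfolding compact_def by metis
    define Y where "Y = X \<circ> r"
    have YM: "Y n \<in> M" and Y1: "norm (Y n) = 1" for n using XM X1 by (auto simp: Y_def)
    \<comment> \<open>Invariance of \<open>M\<close> enters here: the bound by
      \<open>\<sigma>\<close> is applied to \<open>p y\<close> as well as to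
      \<open>y\<close>.\<close>
    have p_le: "norm (p y) \<le> \<sigma>\<^sup>2" if "y \<in> M" "norm y = 1" for y
    proof (cases "p y = 0")
      case False
      have "norm (p y) * norm (p y) = inner (blinfun_apply a y) (blinfun_apply a (p y))"
        by (simp add: power2_norm_eq_inner flip: inner_p power2_eq_square)
      also have "\<dots> \<le> norm (blinfun_apply a y) * norm (blinfun_apply a (p y))"
        by (rule norm_cauchy_schwarz)
      also have "\<dots> \<le> (\<sigma> * norm y) * (\<sigma> * norm (p y))"
        using \<sigma>[OF that(1)] \<sigma>[of "p y"] inv[OF that(1)] \<sigma>0 by (intro mult_mono) (auto simp: p_def)
      finally show ?thesis using False that(2) by (simp add: power2_eq_square)
    qed simp
    have lim: "(\<lambda>n. norm (blinfun_apply a (Y n))) \<longlonglongrightarrow> \<sigma>"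
    proof (rule tendsto_sandwich)
      show "(\<lambda>n. \<sigma> - inverse (real (Suc (r n)))) \<longlonglongrightarrow> \<sigma>"
        using LIMSEQ_subseq_LIMSEQ[OF LIMSEQ_inverse_real_of_nat_add_minus[of \<sigma>] r]
        by (simp add: o_def)
      show "\<forall>\<^sub>F n in sequentially. \<sigma> - inverse (real (Suc (r n))) \<le> norm (blinfun_apply a (Y n))"
        using X(2) by (intro always_eventually allI less_imp_le) (simp add: Y_def del: of_nat_Suc)
      show "\<forall>\<^sub>F n in sequentially. norm (blinfun_apply a (Y n)) \<le> \<sigma>"
        using \<sigma>[OF YM] Y1 by simp
    qed simp
    \<comment> \<open>Expanding the square and inserting
      \<open>norm (p y) \<le> \<sigma>\<^sup>2\<close> leaves \<open>2 \<sigma>\<^sup>2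
      (\<sigma>\<^sup>2 - \<parallel>a y\<parallel>\<^sup>2)\<close>, which vanishes along the
      maximising sequence.\<close>
    have w: "(\<lambda>n. p (Y n) - \<sigma>\<^sup>2 *\<^sub>R Y n) \<longlonglongrightarrow> 0"
    proof -
      have le: "(norm (p (Y n) - \<sigma>\<^sup>2 *\<^sub>R Y n))\<^sup>2
          \<le> 2 * \<sigma>\<^sup>2 * (\<sigma>\<^sup>2 - (norm (blinfun_apply a (Y n)))\<^sup>2)" for n
      proof -
        have "(norm (p (Y n) - \<sigma>\<^sup>2 *\<^sub>R Y n))\<^sup>2
            = (norm (p (Y n)))\<^sup>2 - 2 * \<sigma>\<^sup>2 * (norm (blinfun_apply a (Y n)))\<^sup>2 + (\<sigma>\<^sup>2)\<^sup>2 * (norm (Y n))\<^sup>2"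
          unfolding power2_norm_eq_inner
          by (simp add: inner_diff_left inner_diff_right inner_commute[of "Y n" "p (Y n)"] inner_p power2_eq_square
              algebra_simps)
        moreover have "(norm (p (Y n)))\<^sup>2 \<le> (\<sigma>\<^sup>2)\<^sup>2" using p_le[OF YM Y1] by (intro power_mono) auto
        ultimately show ?thesis by (simp add: Y1 algebra_simps power2_eq_square)
      qed
      have "(\<lambda>n. 2 * \<sigma>\<^sup>2 * (\<sigma>\<^sup>2 - (norm (blinfun_apply a (Y n)))\<^sup>2)) \<longlonglongrightarrow> 2 * \<sigma>\<^sup>2 * (\<sigma>\<^sup>2 - \<sigma>\<^sup>2)"
        by (intro tendsto_intros lim)
      then have "(\<lambda>n. 2 * \<sigma>\<^sup>2 * (\<sigma>\<^sup>2 - (norm (blinfun_apply a (Y n)))\<^sup>2)) \<longlonglongrightarrow> 0" by simp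
      then have "(\<lambda>n. (norm (p (Y n) - \<sigma>\<^sup>2 *\<^sub>R Y n))\<^sup>2) \<longlonglongrightarrow> 0"
        by (rule tendsto_sandwich[OF _ _ tendsto_const, rotated 2]) (auto intro: always_eventually le)
      then have "(\<lambda>n. sqrt ((norm (p (Y n) - \<sigma>\<^sup>2 *\<^sub>R Y n))\<^sup>2)) \<longlonglongrightarrow> sqrt 0" by (rule tendsto_real_sqrt)
      then show ?thesis by (simp add: tendsto_norm_zero_iff)
    qed
    \<comment> \<open>The only possible limit: \<open>p (Y n)\<close> tends to
      \<open>a\<^sup>* z\<close> and differs from \<open>\<sigma>\<^sup>2 Y n\<close> by a null
      sequence. Thus convergence of the images forces convergence of \<open>Y\<close>
      itself.\<close>
    define q where "q = inverse (\<sigma>\<^sup>2) *\<^sub>R blinfun_apply (cadjoint a) z"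
    have "(\<lambda>n. p (Y n)) \<longlonglongrightarrow> blinfun_apply (cadjoint a) z"
      using blinfun.tendsto[OF tendsto_const z, of "cadjoint a"] by (simp add: p_def Y_def o_def)
    from tendsto_scaleR[OF tendsto_const[of "inverse (\<sigma>\<^sup>2)"] tendsto_diff[OF this w]]
    have Yq: "Y \<longlonglongrightarrow> q" using False by (simp add: q_def)
    have "q \<in> M" using closed_sequentially[OF M(1)] YM Yq by blast
    moreover have "norm q = 1"
      using tendsto_norm[OF Yq] by (simp add: Y1 LIMSEQ_const_iff)
    moreover have pq: "p q = \<sigma>\<^sup>2 *\<^sub>R q"
    proof -
      have "(\<lambda>n. p (Y n) - \<sigma>\<^sup>2 *\<^sub>R Y n) \<longlonglongrightarrow> p q - \<sigma>\<^sup>2 *\<^sub>R q"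
        unfolding p_def o_def by (intro tendsto_intros blinfun.tendsto Yq)
      then show ?thesis using LIMSEQ_unique[OF _ w] by fastforce
    qed
    moreover have aq: "norm (blinfun_apply a q) = \<sigma>"
    proof -
      have "(norm (blinfun_apply a q))\<^sup>2 = inner (p q) q" by (simp add: inner_p power2_norm_eq_inner)
      also have "\<dots> = \<sigma>\<^sup>2" using \<open>norm q = 1\<close> by (simp add: pq flip: power2_norm_eq_inner)
      finally show ?thesis using \<sigma>0 by simp
    qed
    ultimately show ?thesis using \<sigma> by (intro bexI[of _ q]) (auto simp: p_def)
  qed
qed

text \<open>The orthogonal complement of a set of eigenvectors of \<open>a\<^sup>* a\<close> is
  closed and invariant, so if nonzero it contains another unit eigenvector and the Zorn extension
  applies. Starting from a maximiser \<open>q0\<close> on the whole space puts \<open>norm a\<close>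
  among the singular values.\<close>

lemma singular_basis_exists:
  fixes a :: "'h::complex_hilbert_space \<Rightarrow>\<^sub>L 'h"
  assumes c: "compact_operator a" and nz: "\<exists>v::'h. v \<noteq> 0"
  shows "\<exists>E. singular_basis a E \<and> (\<exists>e\<in>E. norm (blinfun_apply a e) = norm a)"
proof -
  have a: "a \<in> bounded_operators" using c by (simp add: compact_operator_def)
  let ?p = "\<lambda>x. blinfun_apply (cadjoint a) (blinfun_apply a x)"
  define Q where "Q = {x. ?p x = (norm (blinfun_apply a x))\<^sup>2 *\<^sub>R x}"
  obtain q0 where q0: "norm q0 = 1" "q0 \<in> Q" "\<And>x. norm (blinfun_apply a x) \<le> norm (blinfun_apply a q0) * norm x"
    using maximal_eigenvector[OF c, of UNIV] nz by (auto simp: Q_def)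
  have "norm (blinfun_apply a q0) = norm a"
    using norm_blinfun_bound[OF _ q0(3)] norm_blinfun[of a q0] q0(1) by simp
  have "\<exists>E. orthonormal_basis E \<and> {q0} \<subseteq> E \<and> E \<subseteq> Q"
  proof (rule extend_to_orthonormal_basis)
    show "orthonormal_on {q0} (\<lambda>e. e)" using q0(1) by (simp add: orthonormal_on_id)
    show "{q0} \<subseteq> Q" using q0(2) by simp
    fix E and x :: 'h assume E: "E \<subseteq> Q" and x: "x \<noteq> 0" "\<forall>e\<in>E. cinner x e = 0"
    define M where "M = {x. \<forall>e\<in>E. cinner x e = 0}"
    have "M = (\<Inter>e\<in>E. {x. cinner x e = 0})" by (auto simp: M_def)
    moreover have "closed {x. cinner x e = 0}" for e :: 'h
      by (intro closed_Collect_eq continuous_intros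
          linear_continuous_on[OF bounded_linear_cinner_left])
    ultimately have "closed M" by auto
    moreover have "?p y \<in> M" if "y \<in> M" for y
    proof -
      have "cinner (?p y) e = 0" if "e \<in> E" for e
      proof -
        have "cinner (?p y) e = cinner y (?p e)"
          by (simp add: cinner_cadjoint_left[OF a] cinner_cadjoint[OF a])
        then show ?thesis using E \<open>e \<in> E\<close> \<open>y \<in> M\<close> by (auto simp: Q_def M_def cinner_scaleR_right)
      qed
      then show ?thesis by (simp add: M_def)
    qed
    ultimately obtain q where "q \<in> M" "norm q = 1" "q \<in> Q"
      using maximal_eigenvector[OF c, of M x] x by (auto simp: M_def Q_def cinner_scaleR_left)
    then show "\<exists>q\<in>Q. norm q = 1 \<and> (\<forall>e\<in>E. cinner q e = 0)" by (auto simp: M_def)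
  qed
  then obtain E where E: "orthonormal_basis E" "q0 \<in> E" "E \<subseteq> Q" by blast
  have "cinner (blinfun_apply a e) (blinfun_apply a f) = 0" if "e \<in> E" "f \<in> E" "e \<noteq> f" for e f
  proof -
    have "cinner (blinfun_apply a e) (blinfun_apply a f) = cinner (?p e) f"
      by (simp add: cinner_cadjoint_left[OF a])
    also have "\<dots> = 0"
      using that E by (auto simp: Q_def cinner_scaleR_left orthonormal_basis_def)
    finally show ?thesis .
  qed
  then have "singular_basis a E" using E(1) by (simp add: singular_basis_def)
  then show ?thesis using E(2) \<open>norm (blinfun_apply a q0) = norm a\<close> by blast
qed


section \<open>The trace norm\<close>

lemma sum_le_infsum_ennreal:
  fixes f :: "'a \<Rightarrow> ennreal"
  assumes "finite F" "F \<subseteq> A"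
  shows "sum f F \<le> infsum f A"
  unfolding nonneg_infsum_complete[of A f, simplified] by (rule SUP_upper) (use assms in simp)

text \<open>Half of Tonelli's theorem: a finite outer sum can be moved inside, where it is dominated
  by the full sum. Exchanging the roles of the index sets gives the other half.\<close>

lemma infsum_swap_le_ennreal:
  fixes f :: "'a \<Rightarrow> 'b \<Rightarrow> ennreal"
  shows "(\<Sum>\<^sub>\<infinity>x\<in>A. \<Sum>\<^sub>\<infinity>y\<in>B. f x y) \<le> (\<Sum>\<^sub>\<infinity>y\<in>B. \<Sum>\<^sub>\<infinity>x\<in>A. f x y)"
proof (rule infsum_le_finite_sums)
  fix F assume F: "finite F" "F \<subseteq> A"
  have "(\<Sum>x\<in>F. \<Sum>\<^sub>\<infinity>y\<in>B. f x y) = (\<Sum>\<^sub>\<infinity>y\<in>B. \<Sum>x\<in>F. f x y)"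
    using F(1)
  proof (induction F)
    case (insert x F)
    then show ?case
      using infsum_add[of "f x" B "\<lambda>y. \<Sum>x\<in>F. f x y"]
      by (simp add: nonneg_summable_on_complete)
  qed simp
  also have "\<dots> \<le> (\<Sum>\<^sub>\<infinity>y\<in>B. \<Sum>\<^sub>\<infinity>x\<in>A. f x y)"
    by (intro infsum_mono sum_le_infsum_ennreal F) (simp_all add: nonneg_summable_on_complete)
  finally show "(\<Sum>x\<in>F. \<Sum>\<^sub>\<infinity>y\<in>B. f x y) \<le> (\<Sum>\<^sub>\<infinity>y\<in>B. \<Sum>\<^sub>\<infinity>x\<in>A. f x y)" .
qed (simp add: nonneg_summable_on_complete)

lemma infsum_swap_ennreal:
  fixes f :: "'a \<Rightarrow> 'b \<Rightarrow> ennreal"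
  shows "(\<Sum>\<^sub>\<infinity>x\<in>A. \<Sum>\<^sub>\<infinity>y\<in>B. f x y) = (\<Sum>\<^sub>\<infinity>y\<in>B. \<Sum>\<^sub>\<infinity>x\<in>A. f x y)"
  by (intro antisym infsum_swap_le_ennreal)

lemma infsum_ennreal:
  assumes "(f has_sum s) A" and f: "\<And>x. x \<in> A \<Longrightarrow> 0 \<le> f x"
  shows "(\<Sum>\<^sub>\<infinity>x\<in>A. ennreal (f x)) = ennreal s"
proof (rule infsumI)
  have "((\<lambda>F. ennreal (sum f F)) \<longlongrightarrow> ennreal s) (finite_subsets_at_top A)"
    using assms(1) unfolding has_sum_def by (rule tendsto_ennrealI)
  moreover have "\<forall>\<^sub>F F in finite_subsets_at_top A. ennreal (sum f F) = (\<Sum>x\<in>F. ennreal (f x))"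
    by (rule eventually_finite_subsets_at_top_weakI) (use f in \<open>auto intro!: sum_ennreal[symmetric]\<close>)
  ultimately show "((\<lambda>x. ennreal (f x)) has_sum ennreal s) A"
    unfolding has_sum_def by (rule Lim_transform_eventually)
qed

text \<open>The trace is taken in an unspecified basis \<open>E0\<close>, while
  \<open>abs_operator a\<close> is diagonal in \<open>E\<close>. Expanding each diagonal entry along
  \<open>E\<close> and swapping the nonnegative double sum leaves the Parseval sum of a unit vector
  \<open>e\<close> along \<open>E0\<close>, which is \<open>1\<close>.\<close>

lemma positive_trace_abs_operator:
  assumes a: "a \<in> bounded_operators" and E: "singular_basis a E"
  shows "positive_trace (abs_operator a) = (\<Sum>\<^sub>\<infinity>e\<in>E. ennreal (norm (blinfun_apply a e)))"
proof -
  let ?d = "abs_operator a" and ?n = "\<lambda>e. norm (blinfun_apply a e)"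
  define E0 :: "'a set" where "E0 = (SOME E. orthonormal_basis E)"
  have E0: "orthonormal_basis E0" unfolding E0_def using orthonormal_basis_exists by (rule someI_ex)
  have basis: "orthonormal_basis E" using E by (simp add: singular_basis_def)
  note d = abs_operator_singular_basis[OF a E]
  have "((\<lambda>e. ?n e * (cmod (cinner x e))\<^sup>2) has_sum Re (cinner (blinfun_apply ?d x) x)) E" for x
  proof -
    have "Re (cinner (cinner x e *\<^sub>C blinfun_apply ?d e) x) = ?n e * (cmod (cinner x e))\<^sup>2"
      if "e \<in> E" for e
    proof -
      have "cinner (cinner x e *\<^sub>C blinfun_apply ?d e) x
          = complex_of_real (?n e) * (cinner x e * cinner e x)"
        by (simp add: d(2)[OF that] cinner_simps)
      also have "\<dots> = complex_of_real (?n e * (cmod (cinner x e))\<^sup>2)"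
        unfolding cinner_commute[of e x] complex_norm_square[symmetric] of_real_mult ..
      finally show ?thesis by (simp only: Re_complex_of_real)
    qed
    then show ?thesis
      using has_sum_Re[OF has_sum_bounded_linear[OF bounded_linear_cinner_left
          operator_expansion[OF d(1) basis, of x], of x]]
      by (simp cong: has_sum_cong)
  qed
  then have "positive_trace ?d = (\<Sum>\<^sub>\<infinity>x\<in>E0. \<Sum>\<^sub>\<infinity>e\<in>E. ennreal (?n e * (cmod (cinner x e))\<^sup>2))"
    unfolding positive_trace_def E0_def[symmetric] by (intro infsum_cong infsum_ennreal[symmetric]) auto
  also have "\<dots> = (\<Sum>\<^sub>\<infinity>e\<in>E. \<Sum>\<^sub>\<infinity>x\<in>E0. ennreal (?n e * (cmod (cinner x e))\<^sup>2))"
    by (rule infsum_swap_ennreal)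
  also have "\<dots> = (\<Sum>\<^sub>\<infinity>e\<in>E. ennreal (?n e))"
  proof (intro infsum_cong infsum_ennreal)
    fix e assume "e \<in> E"
    then have "norm e = 1" using basis by (simp add: orthonormal_basis_def)
    then have "((\<lambda>x. ?n e * (cmod (cinner e x))\<^sup>2) has_sum ?n e * 1) E0"
      using has_sum_cmult_right[OF parseval_norm[OF E0, of e]] by simp
    moreover have "cmod (cinner e x) = cmod (cinner x e)" for x
      by (metis cinner_commute complex_mod_cnj)
    ultimately show "((\<lambda>x. ?n e * (cmod (cinner x e))\<^sup>2) has_sum ?n e) E0" by simp
  qed simp
  finally show ?thesis .
qed

text \<open>The finiteness assumption is essential for reading off the trace norm, because
  \<open>enn2real\<close> sends infinity to \<open>0\<close>.\<close>

lemma trace_norm_summable: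
  assumes a: "a \<in> bounded_operators" and E: "singular_basis a E"
    and f: "positive_trace (abs_operator a) < \<infinity>"
  shows "((\<lambda>e. norm (blinfun_apply a e)) has_sum trace_norm a) E"
proof -
  let ?n = "\<lambda>e. norm (blinfun_apply a e)"
  note t = positive_trace_abs_operator[OF a E]
  have "?n summable_on E"
  proof (rule nonneg_bounded_partial_sums_imp_summable_on[where C = "enn2real (\<Sum>\<^sub>\<infinity>e\<in>E. ennreal (?n e))"])
    show "\<forall>\<^sub>F F in finite_subsets_at_top E. sum ?n F \<le> enn2real (\<Sum>\<^sub>\<infinity>e\<in>E. ennreal (?n e))"
    proof (rule eventually_finite_subsets_at_top_weakI)
      fix F assume F: "finite F" "F \<subseteq> E"
      have "ennreal (sum ?n F) \<le> (\<Sum>\<^sub>\<infinity>e\<in>E. ennreal (?n e))"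
        using sum_le_infsum_ennreal[OF F, of "\<lambda>e. ennreal (?n e)"] by (simp add: sum_ennreal)
      then have "enn2real (ennreal (sum ?n F)) \<le> enn2real (\<Sum>\<^sub>\<infinity>e\<in>E. ennreal (?n e))"
        using f t by (intro enn2real_mono) auto
      then show "sum ?n F \<le> enn2real (\<Sum>\<^sub>\<infinity>e\<in>E. ennreal (?n e))" by (simp add: sum_nonneg)
    qed
  qed simp
  then have s: "(?n has_sum infsum ?n E) E" by (rule has_sum_infsum)
  have "positive_trace (abs_operator a) = ennreal (infsum ?n E)"
    unfolding t by (rule infsum_ennreal[OF s]) simp
  then have "trace_norm a = infsum ?n E" by (simp add: trace_norm_def infsum_nonneg)
  then show ?thesis using s by simp
qed

text \<open>
  For compact \<open>a\<close> this says \<open>\<parallel>a\<parallel>\<^sub>1 \<le> c\<close>; in this form the triangle inequality and the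
  invariance under adjoints are immediate.
\<close>

definition trace_le :: "('h::complex_hilbert_space \<Rightarrow>\<^sub>L 'h) \<Rightarrow> real \<Rightarrow> bool"
  where "trace_le a c \<longleftrightarrow> (\<forall>(I::nat set) x y. finite I \<longrightarrow> orthonormal_on I x \<longrightarrow> orthonormal_on I y \<longrightarrow>
    (\<Sum>i\<in>I. Re (cinner (blinfun_apply a (x i)) (y i))) \<le> c)"

lemma trace_leD:
  fixes I :: "nat set"
  assumes "trace_le a c" "finite I" "orthonormal_on I x" "orthonormal_on I y"
  shows "(\<Sum>i\<in>I. Re (cinner (blinfun_apply a (x i)) (y i))) \<le> c"
  using assms unfolding trace_le_def by blast

lemma trace_le_mono: "trace_le a c \<Longrightarrow> c \<le> d \<Longrightarrow> trace_le a d"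
  unfolding trace_le_def by (meson order_trans)

lemma trace_le_add:
  assumes "trace_le a c" "trace_le b d"
  shows "trace_le (a + b) (c + d)"
  unfolding trace_le_def
proof (intro allI impI)
  fix I :: "nat set" and x y :: "nat \<Rightarrow> 'a"
  assume "finite I" "orthonormal_on I x" "orthonormal_on I y"
  from trace_leD[OF assms(1) this] trace_leD[OF assms(2) this]
  show "(\<Sum>i\<in>I. Re (cinner (blinfun_apply (a + b) (x i)) (y i))) \<le> c + d"
    by (simp add: blinfun.add_left cinner_add_left sum.distrib)
qed

lemma trace_le_scaleR:
  assumes "trace_le a c" "r \<ge> 0"
  shows "trace_le (r *\<^sub>R a) (r * c)"
  unfolding trace_le_def
proof (intro allI impI)
  fix I :: "nat set" and x y :: "nat \<Rightarrow> 'a"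
  assume "finite I" "orthonormal_on I x" "orthonormal_on I y"
  from mult_left_mono[OF trace_leD[OF assms(1) this] assms(2)]
  show "(\<Sum>i\<in>I. Re (cinner (blinfun_apply (r *\<^sub>R a) (x i)) (y i))) \<le> r * c"
    by (simp add: blinfun.scaleR_left cinner_scaleR_left sum_distrib_left)
qed

lemma orthonormal_on_uminus: "orthonormal_on I y \<Longrightarrow> orthonormal_on I (\<lambda>i. - y i)"
  by (simp add: orthonormal_on_def cinner_minus_left cinner_minus_right)

lemma trace_le_uminus:
  assumes "trace_le a c"
  shows "trace_le (- a) c"
  unfolding trace_le_def
proof (intro allI impI)
  fix I :: "nat set" and x y :: "nat \<Rightarrow> 'a"
  assume "finite I" "orthonormal_on I x" "orthonormal_on I y"
  from trace_leD[OF assms this(1,2) orthonormal_on_uminus[OF this(3)]]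
  show "(\<Sum>i\<in>I. Re (cinner (blinfun_apply (- a) (x i)) (y i))) \<le> c"
    by (simp add: blinfun.minus_left cinner_minus_left cinner_minus_right)
qed

lemma trace_le_cadjoint:
  assumes a: "a \<in> bounded_operators" and "trace_le a c"
  shows "trace_le (cadjoint a) c"
  unfolding trace_le_def
proof (intro allI impI)
  fix I :: "nat set" and x y :: "nat \<Rightarrow> 'a"
  assume "finite I" "orthonormal_on I x" "orthonormal_on I y"
  from trace_leD[OF assms(2) this(1,3,2)]
  show "(\<Sum>i\<in>I. Re (cinner (blinfun_apply (cadjoint a) (x i)) (y i))) \<le> c"
    by (simp add: cinner_cadjoint_left[OF a] inner_commute flip: inner_eq_Re_cinner)
qed

text \<open>One-element families suffice: the normalised \<open>x\<close> against the normalised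
  image. The empty family supplies \<open>c \<ge> 0\<close> for the degenerate case.\<close>

lemma norm_le_trace_bound:
  assumes "trace_le a c"
  shows "norm (blinfun_apply a x) \<le> c * norm x"
proof (cases "x = 0 \<or> blinfun_apply a x = 0")
  case True
  have "c \<ge> 0" using trace_leD[OF assms, of "{}"] by (simp add: orthonormal_on_def)
  then show ?thesis using True by (auto simp: blinfun.zero_right)
next
  case False
  have "orthonormal_on {0::nat} (\<lambda>_. sgn z)" if "z \<noteq> 0" for z :: 'a
    using that by (simp add: orthonormal_on_def cinner_self norm_sgn)
  from trace_leD[OF assms _ this[of x] this[of "blinfun_apply a x"]] False
  have "inner (blinfun_apply a (sgn x)) (sgn (blinfun_apply a x)) \<le> c"
    by (simp add: inner_eq_Re_cinner)
  then have "norm (blinfun_apply a x) / norm x \<le> c"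
    using False by (simp add: sgn_div_norm blinfun.scaleR_right dot_square_norm power2_eq_square
        field_simps)
  then show ?thesis using False by (simp add: divide_le_eq)
qed

text \<open>Expand every \<open>x i\<close> along \<open>E\<close>. For fixed \<open>e\<close>,
  Cauchy-Schwarz over \<open>i\<close> and two Bessel inequalities bound the contribution by
  \<open>norm (a e)\<close>. Since \<open>E\<close> is any orthonormal basis, the bound can be used
  for a perturbed operator in a singular basis of the original one.\<close>

lemma trace_le_has_sum:
  assumes a: "a \<in> bounded_operators" and E: "orthonormal_basis E"
    and s: "((\<lambda>e. norm (blinfun_apply a e)) has_sum s) E"
  shows "trace_le a s"
  unfolding trace_le_def
proof (intro allI impI)
  fix I :: "nat set" and x y :: "nat \<Rightarrow> 'a"
  assume I: "finite I" and x: "orthonormal_on I x" and y: "orthonormal_on I y"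
  let ?g = "\<lambda>e. \<Sum>i\<in>I. Re (cinner (x i) e * cinner (blinfun_apply a e) (y i))"
  have h: "((\<lambda>e. Re (cinner (x i) e * cinner (blinfun_apply a e) (y i))) has_sum
      Re (cinner (blinfun_apply a (x i)) (y i))) E" for i
    using has_sum_Re[OF has_sum_bounded_linear[OF bounded_linear_cinner_left
        operator_expansion[OF a E, of "x i"], of "y i"]]
    by (simp add: cinner_scaleC_left)
  have g: "(?g has_sum (\<Sum>i\<in>I. Re (cinner (blinfun_apply a (x i)) (y i)))) E"
    using I by (induction rule: finite_induct) (simp_all add: has_sum_add h del: times_complex.sel)
  have "?g e \<le> norm (blinfun_apply a e)" if "e \<in> E" for e
  proof -
    have "?g e \<le> (\<Sum>i\<in>I. \<bar>cmod (cinner (x i) e)\<bar> * \<bar>cmod (cinner (blinfun_apply a e) (y i))\<bar>)"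
      by (intro sum_mono order.trans[OF complex_Re_le_cmod]) (simp add: norm_mult)
    also have "\<dots> \<le> L2_set (\<lambda>i. cmod (cinner (x i) e)) I *
        L2_set (\<lambda>i. cmod (cinner (blinfun_apply a e) (y i))) I"
      by (rule L2_set_mult_ineq)
    also have "\<dots> \<le> 1 * norm (blinfun_apply a e)"
    proof (intro mult_mono)
      have c: "cmod (cinner e (x i)) = cmod (cinner (x i) e)" for i
        by (metis cinner_commute complex_mod_cnj)
      have "norm e = 1" using that E by (simp add: orthonormal_basis_def)
      then have "(\<Sum>i\<in>I. (cmod (cinner (x i) e))\<^sup>2) \<le> 1"
        using bessel_inequality[OF I x, of e] by (simp add: c)
      then show "L2_set (\<lambda>i. cmod (cinner (x i) e)) I \<le> 1"
        unfolding L2_set_def by simp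
      show "L2_set (\<lambda>i. cmod (cinner (blinfun_apply a e) (y i))) I \<le> norm (blinfun_apply a e)"
        unfolding L2_set_def by (rule real_le_lsqrt) (use bessel_inequality[OF I y] in auto)
    qed (simp_all add: L2_set_nonneg)
    finally show ?thesis by simp
  qed
  then show "(\<Sum>i\<in>I. Re (cinner (blinfun_apply a (x i)) (y i))) \<le> s"
    by (rule has_sum_mono[OF g s])
qed

text \<open>The matching left singular vectors are \<open>sgn (a e)\<close>. As
  \<open>sgn 0 = 0\<close> is not a unit vector, kernel vectors are removed before indexing; they
  add nothing to the sum.\<close>

lemma singular_families:
  assumes E: "singular_basis a E" and F: "finite F" "F \<subseteq> E"
  shows "\<exists>(I::nat set) x y. finite I \<and> orthonormal_on I x \<and> orthonormal_on I y \<and>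
    (\<Sum>i\<in>I. Re (cinner (blinfun_apply a (x i)) (y i))) = (\<Sum>e\<in>F. norm (blinfun_apply a e))"
proof -
  define G where "G = {e\<in>F. blinfun_apply a e \<noteq> 0}"
  have G: "finite G" "G \<subseteq> E" using F by (auto simp: G_def)
  obtain g where g: "bij_betw g {0..<card G} G" using ex_bij_betw_nat_finite[OF G(1)] by blast
  let ?I = "{0..<card G}"
  have on: "orthonormal_on G (\<lambda>e. e)"
    using E G(2) by (auto simp: singular_basis_def orthonormal_basis_iff intro: orthonormal_on_subset)
  have inner1: "cinner (blinfun_apply a e) (sgn (blinfun_apply a e)) = norm (blinfun_apply a e)" for e
    by (cases "blinfun_apply a e = 0") (simp_all add: sgn_div_norm cinner_simps cinner_self power2_eq_square)
  have "orthonormal_on G (\<lambda>e. sgn (blinfun_apply a e))"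
    unfolding orthonormal_on_def
  proof (intro ballI)
    fix e f assume ef: "e \<in> G" "f \<in> G"
    show "cinner (sgn (blinfun_apply a e)) (sgn (blinfun_apply a f)) = (if e = f then 1 else 0)"
    proof (cases "e = f")
      case True
      then show ?thesis using ef by (simp add: cinner_self norm_sgn G_def)
    next
      case False
      then have "cinner (blinfun_apply a e) (blinfun_apply a f) = 0"
        using E ef G(2) unfolding singular_basis_def by blast
      then show ?thesis using False by (simp add: sgn_div_norm cinner_simps)
    qed
  qed
  then have "orthonormal_on ?I ((\<lambda>e. sgn (blinfun_apply a e)) \<circ> g)"
    using g by (intro orthonormal_on_reindex) (auto simp: bij_betw_def)
  moreover have "orthonormal_on ?I ((\<lambda>e. e) \<circ> g)"
    using g by (intro orthonormal_on_reindex[OF on]) (auto simp: bij_betw_def)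
  moreover have "(\<Sum>i\<in>?I. Re (cinner (blinfun_apply a (((\<lambda>e. e) \<circ> g) i)) (((\<lambda>e. sgn (blinfun_apply a e)) \<circ> g) i)))
      = (\<Sum>e\<in>F. norm (blinfun_apply a e))"
  proof -
    have "(\<Sum>i\<in>?I. Re (cinner (blinfun_apply a (((\<lambda>e. e) \<circ> g) i)) (((\<lambda>e. sgn (blinfun_apply a e)) \<circ> g) i)))
        = (\<Sum>i\<in>?I. norm (blinfun_apply a (g i)))"
      by (simp add: inner1)
    also have "\<dots> = (\<Sum>e\<in>G. norm (blinfun_apply a e))" by (rule sum.reindex_bij_betw[OF g])
    also have "\<dots> = (\<Sum>e\<in>F. norm (blinfun_apply a e))"
      by (rule sum.mono_neutral_left) (use F in \<open>auto simp: G_def\<close>)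
    finally show ?thesis .
  qed
  ultimately show ?thesis by (intro exI conjI) (rule finite_atLeastLessThan)
qed

lemma trace_le_imp_positive_trace_le:
  assumes a: "a \<in> bounded_operators" and E: "singular_basis a E" and c: "trace_le a c"
  shows "positive_trace (abs_operator a) \<le> ennreal c"
  unfolding positive_trace_abs_operator[OF a E]
proof (rule infsum_le_finite_sums)
  fix F assume F: "finite F" "F \<subseteq> E"
  obtain I :: "nat set" and x y where "finite I" "orthonormal_on I x" "orthonormal_on I y"
    "(\<Sum>i\<in>I. Re (cinner (blinfun_apply a (x i)) (y i))) = (\<Sum>e\<in>F. norm (blinfun_apply a e))"
    using singular_families[OF E F] by blast
  then have "(\<Sum>e\<in>F. norm (blinfun_apply a e)) \<le> c" using trace_leD[OF c] by metis
  then show "(\<Sum>e\<in>F. ennreal (norm (blinfun_apply a e))) \<le> ennreal c"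
    by (simp add: sum_ennreal ennreal_leI)
qed (simp add: nonneg_summable_on_complete)

text \<open>Trades the operator absolute value, which behaves badly under sums, for a bound that
  passes directly to sums, nonnegative multiples and adjoints.\<close>

lemma trace_class_ball_iff:
  fixes a :: "'h::complex_hilbert_space \<Rightarrow>\<^sub>L 'h"
  assumes nz: "\<exists>v::'h. v \<noteq> 0"
  shows "a \<in> trace_class_ball \<longleftrightarrow> compact_operator a \<and> trace_le a 1"
proof (cases "compact_operator a")
  case True
  then have a: "a \<in> bounded_operators" by (simp add: compact_operator_def)
  obtain E where E: "singular_basis a E" using singular_basis_exists[OF True nz] by blast
  show ?thesis
  proof
    assume "a \<in> trace_class_ball"
    then have f: "positive_trace (abs_operator a) < \<infinity>" "trace_norm a \<le> 1"
      by (auto simp: trace_class_ball_def trace_class_def)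
    have "trace_le a (trace_norm a)"
      using E by (intro trace_le_has_sum[OF a _ trace_norm_summable[OF a E f(1)]])
        (simp add: singular_basis_def)
    then show "compact_operator a \<and> trace_le a 1" using f(2) True trace_le_mono by blast
  next
    assume "compact_operator a \<and> trace_le a 1"
    then have le: "positive_trace (abs_operator a) \<le> ennreal 1"
      using trace_le_imp_positive_trace_le[OF a E] by blast
    then have "trace_norm a \<le> 1" unfolding trace_norm_def using enn2real_mono[OF le] by simp
    moreover have "positive_trace (abs_operator a) < \<infinity>"
      using le by (rule order.strict_trans1) simp
    ultimately show "a \<in> trace_class_ball" using True by (simp add: trace_class_ball_def trace_class_def)
  qed
qed (simp add: trace_class_ball_def trace_class_def)


section \<open>Rank one operators\<close>

definition rank_one :: "'h::complex_hilbert_space \<Rightarrow> 'h \<Rightarrow> ('h \<Rightarrow>\<^sub>L 'h)"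
  where "rank_one u v = Blinfun (\<lambda>x. cinner x v *\<^sub>C u)"

lemma rank_one_apply: "blinfun_apply (rank_one u v) x = cinner x v *\<^sub>C u"
proof -
  have "bounded_linear (\<lambda>x. cinner x v *\<^sub>C u)"
    by (rule bounded_linear_intro[of _ "norm v * norm u"])
      (simp_all add: cinner_simps scaleC_add_left scaleR_eq_scaleC scaleC_scaleC norm_scaleC
        mult_right_mono norm_cinner_le flip: mult.assoc)
  then show ?thesis unfolding rank_one_def by (simp add: bounded_linear_Blinfun_apply)
qed

lemma rank_one_bounded: "rank_one u v \<in> bounded_operators"
  by (simp add: bounded_operators_def rank_one_apply cinner_scaleC_left scaleC_scaleC)

section \<open>Compactness of rank one operators and of linear combinations\<close>

lemma compact_closure_subset:
  fixes S K :: "'a::t2_space set"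
  assumes "compact K" "S \<subseteq> K"
  shows "compact (closure S)"
proof -
  have "closure S \<subseteq> K" using assms by (intro closure_minimal compact_imp_closed)
  then show ?thesis using compact_Int_closed[OF assms(1) closed_closure, of S] by (simp add: Int_absorb1)
qed

lemma compact_operator_rank_one: "compact_operator (rank_one u v)"
proof -
  have "compact ((\<lambda>c. c *\<^sub>C u) ` cball 0 (norm v))"
  proof (rule compact_continuous_image)
    have "bounded_linear (\<lambda>c. c *\<^sub>C u)"
      by (rule bounded_linear_intro[of _ "norm u"])
        (simp_all add: scaleC_add_left scaleR_eq_scaleC scaleC_scaleC norm_scaleC scaleR_conv_of_real
          scaleC_complex_def)
    then show "continuous_on (cball 0 (norm v)) (\<lambda>c. c *\<^sub>C u)" by (rule linear_continuous_on)
  qed simp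
  moreover have "blinfun_apply (rank_one u v) ` cball 0 1 \<subseteq> (\<lambda>c. c *\<^sub>C u) ` cball 0 (norm v)"
  proof
    fix y assume "y \<in> blinfun_apply (rank_one u v) ` cball 0 1"
    then obtain x where x: "norm x \<le> 1" "y = cinner x v *\<^sub>C u" by (auto simp: rank_one_apply)
    have "cmod (cinner x v) \<le> norm v"
      using norm_cinner_le[of x v] mult_right_mono[OF x(1), of "norm v"] by simp
    then show "y \<in> (\<lambda>c. c *\<^sub>C u) ` cball 0 (norm v)" using x by auto
  qed
  ultimately show ?thesis
    unfolding compact_operator_def using rank_one_bounded compact_closure_subset by blast
qed

lemma compact_operator_scaleR:
  assumes "compact_operator a"
  shows "compact_operator (r *\<^sub>R a)"
proof -
  have a: "a \<in> bounded_operators" and c: "compact (closure (blinfun_apply a ` cball 0 1))"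
    using assms by (auto simp: compact_operator_def)
  have "blinfun_apply (r *\<^sub>R a) ` cball 0 1 \<subseteq> (\<lambda>x. r *\<^sub>R x) ` closure (blinfun_apply a ` cball 0 1)"
    using closure_subset[of "blinfun_apply a ` cball 0 1"] by (auto simp: blinfun.scaleR_left)
  then have "compact (closure (blinfun_apply (r *\<^sub>R a) ` cball 0 1))"
    by (rule compact_closure_subset[OF compact_scaling[OF c]])
  moreover have "r *\<^sub>R a \<in> bounded_operators"
    using a by (simp add: bounded_operators_def blinfun.scaleR_left scaleR_eq_scaleC scaleC_scaleC mult.commute)
  ultimately show ?thesis by (simp add: compact_operator_def)
qed

lemma compact_operator_add:
  assumes "compact_operator a" "compact_operator b"
  shows "compact_operator (a + b)"
proof -
  let ?A = "closure (blinfun_apply a ` cball 0 1)" and ?B = "closure (blinfun_apply b ` cball 0 1)"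
  have ab: "a \<in> bounded_operators" "b \<in> bounded_operators" and c: "compact ?A" "compact ?B"
    using assms by (auto simp: compact_operator_def)
  have "blinfun_apply (a + b) ` cball 0 1 \<subseteq> (\<Union>x\<in>?A. \<Union>y\<in>?B. {x + y})"
  proof
    fix z assume "z \<in> blinfun_apply (a + b) ` cball 0 1"
    then obtain x where x: "x \<in> cball 0 1" "z = blinfun_apply a x + blinfun_apply b x"
      by (auto simp: blinfun.add_left)
    have "blinfun_apply a x \<in> ?A" "blinfun_apply b x \<in> ?B"
      by (intro subsetD[OF closure_subset] imageI x(1))+
    then show "z \<in> (\<Union>x\<in>?A. \<Union>y\<in>?B. {x + y})" using x(2) by blast
  qed
  then have "compact (closure (blinfun_apply (a + b) ` cball 0 1))"
    by (rule compact_closure_subset[OF compact_sums'[OF c]])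
  moreover have "a + b \<in> bounded_operators"
    using ab by (simp add: bounded_operators_def blinfun.add_left scaleC_add_right)
  ultimately show ?thesis by (simp add: compact_operator_def)
qed

lemma trace_le_rank_one:
  assumes "norm u = 1" "norm v = 1"
  shows "trace_le (rank_one u v) 1"
  unfolding trace_le_def
proof (intro allI impI)
  fix I :: "nat set" and x y :: "nat \<Rightarrow> 'a"
  assume I: "finite I" and x: "orthonormal_on I x" and y: "orthonormal_on I y"
  have c: "cmod (cinner (x i) v) = cmod (cinner v (x i))" for i
    by (metis cinner_commute complex_mod_cnj)
  have "(\<Sum>i\<in>I. Re (cinner (blinfun_apply (rank_one u v) (x i)) (y i)))
      \<le> (\<Sum>i\<in>I. \<bar>cmod (cinner v (x i))\<bar> * \<bar>cmod (cinner u (y i))\<bar>)"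
    by (intro sum_mono order.trans[OF complex_Re_le_cmod])
      (simp add: rank_one_apply cinner_scaleC_left norm_mult c)
  also have "\<dots> \<le> L2_set (\<lambda>i. cmod (cinner v (x i))) I * L2_set (\<lambda>i. cmod (cinner u (y i))) I"
    by (rule L2_set_mult_ineq)
  also have "\<dots> \<le> 1 * 1"
    using bessel_inequality[OF I x, of v] bessel_inequality[OF I y, of u] assms
    by (intro mult_mono) (simp_all add: L2_set_def sum_nonneg)
  finally show "(\<Sum>i\<in>I. Re (cinner (blinfun_apply (rank_one u v) (x i)) (y i))) \<le> 1" by simp
qed

lemma rank_one_in_trace_class_ball:
  assumes "norm u = 1" "norm v = 1"
  shows "rank_one u v \<in> trace_class_ball"
proof -
  have "u \<noteq> 0" using assms(1) by auto
  then show ?thesis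
    using trace_class_ball_iff compact_operator_rank_one trace_le_rank_one[OF assms] by blast
qed

text \<open>The pair \<open>(v, u)\<close> already exhausts the trace bound \<open>1\<close>. The
  norm bounds force \<open>b v = u\<close> and \<open>b\<^sup>* u = v\<close>, so \<open>b\<close>
  maps the complement of \<open>v\<close> into that of \<open>u\<close>. A nonzero
  \<open>b x\<close> there would give a second orthonormal pair with positive contribution.\<close>

lemma eq_rank_one_if_trace_le:
  assumes b: "b \<in> bounded_operators" "trace_le b 1"
    and u: "norm u = 1" and v: "norm v = 1" and 1: "cinner (blinfun_apply b v) u = 1"
  shows "b = rank_one u v"
proof -
  have le: "norm (blinfun_apply b x) \<le> norm x" for x using norm_le_trace_bound[OF b(2), of x] by simp
  have bv: "blinfun_apply b v = u"
    by (rule cinner_eq_unit_imp_eq) (use le[of v] u v 1 in auto)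
  have bu: "blinfun_apply (cadjoint b) u = v"
  proof (rule cinner_eq_unit_imp_eq)
    let ?w = "blinfun_apply (cadjoint b) u"
    have "norm b \<le> 1" by (rule norm_blinfun_bound) (simp_all add: le)
    then show "norm ?w \<le> 1"
      using norm_blinfun[of "cadjoint b" u] norm_cadjoint_le[OF b(1)] u by simp
    show "cinner ?w v = 1" using u by (simp add: cinner_cadjoint_left[OF b(1)] bv cinner_self)
  qed (fact v)
  have perp: "blinfun_apply b x = 0" if x: "cinner x v = 0" for x
  proof (rule ccontr)
    assume bx: "blinfun_apply b x \<noteq> 0"
    then have x0: "x \<noteq> 0" by (auto simp: blinfun.zero_right)
    have bxu: "cinner (blinfun_apply b x) u = 0" by (simp add: cinner_cadjoint[OF b(1)] bu x)
    have on: "orthonormal_on {0, Suc 0} (\<lambda>i. if i = 0 then p else sgn q)"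
      if "norm p = 1" "q \<noteq> 0" "cinner q p = 0" for p q :: 'a
    proof -
      have "cinner p q = 0" using that(3) cinner_commute[of p q] by simp
      then have "cinner p (sgn q) = 0" "cinner (sgn q) p = 0"
        using that(3) by (simp_all add: sgn_div_norm cinner_simps)
      then show ?thesis using that by (auto simp: orthonormal_on_def cinner_self norm_sgn)
    qed
    have "(\<Sum>i\<in>{0, Suc 0}. Re (cinner (blinfun_apply b (if i = 0 then v else sgn x))
        (if i = 0 then u else sgn (blinfun_apply b x)))) \<le> 1"
      using trace_leD[OF b(2) _ on[OF v x0 x] on[OF u bx bxu]] by simp
    then have "inner (blinfun_apply b (sgn x)) (sgn (blinfun_apply b x)) \<le> 0"
      using 1 by (simp add: inner_eq_Re_cinner)
    then have "norm (blinfun_apply b x) / norm x \<le> 0"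
      using bx by (simp add: sgn_div_norm blinfun.scaleR_right dot_square_norm power2_eq_square field_simps)
    then show False using bx x0 by (simp add: divide_le_0_iff)
  qed
  show ?thesis
  proof (rule blinfun_eqI)
    fix x
    have "cinner (x - cinner x v *\<^sub>C v) v = 0" using v by (simp add: cinner_simps cinner_self)
    from perp[OF this] show "blinfun_apply b x = blinfun_apply (rank_one u v) x"
      by (simp add: blinfun.diff_right bounded_operators_scaleC[OF b(1)] bv rank_one_apply)
  qed
qed

text \<open>The functional \<open>b \<mapsto> cinner (b v) u\<close> has modulus at most
  \<open>1\<close> on the ball and equals \<open>1\<close> only at \<open>rank_one u v\<close>. Both
  ends of a segment through this point must attain the value \<open>1\<close>.\<close>

lemma rank_one_extreme_point:
  assumes u: "norm u = 1" and v: "norm v = 1"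
  shows "rank_one u v extreme_point_of trace_class_ball"
  unfolding extreme_point_of_def
proof (intro conjI ballI notI)
  show "rank_one u v \<in> trace_class_ball" by (rule rank_one_in_trace_class_ball[OF assms])
  have nz: "\<exists>v::'a. v \<noteq> 0" using u by (intro exI[of _ u]) auto
  fix b c :: "'a \<Rightarrow>\<^sub>L 'a" assume "b \<in> trace_class_ball" "c \<in> trace_class_ball"
  then have B: "b \<in> bounded_operators" "trace_le b 1" and C: "c \<in> bounded_operators" "trace_le c 1"
    by (auto simp: trace_class_ball_iff[OF nz] compact_operator_def)
  assume "rank_one u v \<in> open_segment b c"
  then obtain \<theta> where \<theta>: "b \<noteq> c" "0 < \<theta>" "\<theta> < 1" "rank_one u v = (1 - \<theta>) *\<^sub>R b + \<theta> *\<^sub>R c"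
    by (auto simp: in_segment)
  have le: "cmod (cinner (blinfun_apply d v) u) \<le> 1" if "trace_le d 1" for d
    using norm_cinner_le[of "blinfun_apply d v" u] norm_le_trace_bound[OF that, of v] u v by simp
  have eq1: "z = 1" if "Re z = 1" "cmod z \<le> 1" for z
  proof -
    have "(cmod z)\<^sup>2 \<le> 1" using that(2) by (simp add: power_le_one)
    then have "(Im z)\<^sup>2 \<le> 0" using that(1) by (simp add: cmod_power2)
    then show ?thesis using that(1) by (simp add: complex_eq_iff)
  qed
  have "(1 - \<theta>) * Re (cinner (blinfun_apply b v) u) + \<theta> * Re (cinner (blinfun_apply c v) u)
      = Re (cinner (blinfun_apply (rank_one u v) v) u)"
    unfolding \<theta>(4) by (simp add: blinfun.add_left blinfun.scaleR_left cinner_simps)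
  also have "\<dots> = 1" using u v by (simp add: rank_one_apply cinner_simps cinner_self)
  finally have sum: "(1 - \<theta>) * Re (cinner (blinfun_apply b v) u) + \<theta> * Re (cinner (blinfun_apply c v) u) = 1" .
  have "Re (cinner (blinfun_apply b v) u) \<le> 1" "Re (cinner (blinfun_apply c v) u) \<le> 1"
    using le[OF B(2)] le[OF C(2)] complex_Re_le_cmod order_trans by blast+
  moreover from this have "(1 - \<theta>) * Re (cinner (blinfun_apply b v) u) \<le> 1 - \<theta>"
    "\<theta> * Re (cinner (blinfun_apply c v) u) \<le> \<theta>"
    using \<theta>(2,3) mult_left_mono[of _ 1 "1 - \<theta>"] mult_left_mono[of _ 1 "\<theta>"] by auto
  ultimately have "(1 - \<theta>) * Re (cinner (blinfun_apply b v) u) = 1 - \<theta>"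
    "\<theta> * Re (cinner (blinfun_apply c v) u) = \<theta>" using sum by linarith+
  then have "Re (cinner (blinfun_apply b v) u) = 1" "Re (cinner (blinfun_apply c v) u) = 1"
    using \<theta>(2,3) by auto
  then have "b = rank_one u v" "c = rank_one u v"
    using eq_rank_one_if_trace_le[OF B u v eq1[OF _ le[OF B(2)]]]
      eq_rank_one_if_trace_le[OF C u v eq1[OF _ le[OF C(2)]]] by auto
  then show False using \<theta>(1) by simp
qed

section \<open>Attainment\<close>

lemma trace_class_ball_singular:
  fixes a :: "'h::complex_hilbert_space \<Rightarrow>\<^sub>L 'h"
  assumes "a \<in> trace_class_ball" "singular_basis a E"
  shows "((\<lambda>e. norm (blinfun_apply a e)) has_sum trace_norm a) E"
  using assms
  by (intro trace_norm_summable) (auto simp: trace_class_ball_def trace_class_def compact_operator_def)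

text \<open>
  Here \<open>u\<close> and \<open>v\<close> are top singular vectors of \<open>a\<close>, so subtracting \<open>\<lambda>\<close> times \<open>rank_one u v\<close> only
  changes the top singular value.
\<close>

lemma attained_decomposition:
  fixes a :: "'h::complex_hilbert_space \<Rightarrow>\<^sub>L 'h"
  assumes nz: "\<exists>v::'h. v \<noteq> 0" and a: "a \<in> trace_class_ball"
    and l: "l = (1 - trace_norm a + 2 * norm a) / 2"
  shows "0 < l \<and> l \<le> 1 \<and> (\<exists>u v y. norm u = 1 \<and> norm v = 1 \<and> y \<in> trace_class_ball \<and>
    a = l *\<^sub>R rank_one u v + (1 - l) *\<^sub>R y)"
proof -
  have c: "compact_operator a" and t1: "trace_norm a \<le> 1"
    using a by (auto simp: trace_class_ball_def trace_class_def)
  have aB: "a \<in> bounded_operators" using c by (simp add: compact_operator_def)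
  obtain E v where E: "singular_basis a E" and v: "v \<in> E" "norm (blinfun_apply a v) = norm a"
    using singular_basis_exists[OF c nz] by blast
  have basis: "orthonormal_basis E" using E by (simp add: singular_basis_def)
  have on: "orthonormal_on E (\<lambda>e. e)" using basis by (simp add: orthonormal_basis_iff)
  have v1: "norm v = 1" using orthonormal_on_norm[OF on v(1)] .
  \<comment> \<open>For \<open>a = 0\<close> the normalised image would be \<open>0\<close>; any
    unit vector then serves as \<open>u\<close>.\<close>
  define u where "u = (if a = 0 then v else sgn (blinfun_apply a v))"
  have u1: "norm u = 1" using v v1 by (auto simp: u_def norm_sgn)
  have av: "blinfun_apply a v = norm a *\<^sub>R u"
  proof (cases "a = 0")
    case False
    then show ?thesis using v(2) by (simp add: u_def sgn_div_norm)
  qed simp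
  define r where "r = rank_one u v"
  have s: "((\<lambda>e. norm (blinfun_apply a e)) has_sum trace_norm a) E"
    by (rule trace_class_ball_singular[OF a E])
  \<comment> \<open>The intermediate operator with the top singular value at \<open>v\<close>
    removed entirely; on the rest of \<open>E\<close> it agrees with \<open>a\<close>.\<close>
  define b where "b = a + (- norm a) *\<^sub>R r"
  have b: "compact_operator b"
    unfolding b_def r_def by (intro compact_operator_add compact_operator_scaleR compact_operator_rank_one c)
  have be: "norm (blinfun_apply b e) = norm (blinfun_apply a e) + (if e = v then - norm a else 0)"
    if "e \<in> E" for e
    using orthonormal_onD[OF on that v(1)] av v(2)
    by (auto simp: b_def r_def blinfun.diff_left blinfun.scaleR_left rank_one_apply)
  have "((\<lambda>e. norm (blinfun_apply a e) + (if e = v then - norm a else 0)) has_sum (trace_norm a + - norm a)) E"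
    by (intro has_sum_add s has_sum_finite_neutralI[of "{v}"]) (use v in auto)
  then have "((\<lambda>e. norm (blinfun_apply b e)) has_sum (trace_norm a - norm a)) E"
    unfolding diff_conv_add_uminus by (simp only: be cong: has_sum_cong)
  then have tb: "trace_le b (trace_norm a - norm a)"
    using b by (intro trace_le_has_sum[OF _ basis]) (auto simp: compact_operator_def)
  define d where "d = a + (- l) *\<^sub>R r"
  have d: "compact_operator d"
    unfolding d_def r_def by (intro compact_operator_add compact_operator_scaleR compact_operator_rank_one c)
  \<comment> \<open>Here \<open>l - norm a = (1 - trace_norm a) / 2\<close> is nonnegative, so
    subtracting the remaining multiple of \<open>r\<close> costs at most that amount by the triangle
    inequality. The value of \<open>l\<close> makes the total \<open>1 - l\<close>.\<close>
  have "trace_le (b + (l - norm a) *\<^sub>R (- r)) (trace_norm a - norm a + (l - norm a) * 1)"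
    unfolding r_def using t1 l
    by (intro trace_le_add tb trace_le_scaleR trace_le_uminus trace_le_rank_one u1 v1) simp
  moreover have "b + (l - norm a) *\<^sub>R (- r) = d" by (simp add: b_def d_def algebra_simps)
  moreover have "trace_norm a - norm a + (l - norm a) * 1 = 1 - l" by (simp add: l field_simps)
  ultimately have td: "trace_le d (1 - l)" by metis
  have "l \<le> 1" using trace_leD[OF td, of "{}"] by (simp add: orthonormal_on_def)
  \<comment> \<open>Both \<open>1 - trace_norm a\<close> and \<open>norm a\<close> are nonnegative,
    so \<open>l \<le> 0\<close> would make \<open>a\<close> a zero operator of trace norm
    \<open>1\<close>.\<close>
  have "0 < l"
  proof (rule ccontr)
    assume "\<not> 0 < l"
    then have "1 - trace_norm a + 2 * norm a \<le> 0" by (simp add: l)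
    with t1 norm_ge_zero[of a] have "trace_norm a = 1" "norm a = 0" by linarith+
    then show False using has_sum_unique[OF s, of 0] by simp
  qed
  have ad: "a = l *\<^sub>R r + d" by (simp add: d_def)
  have "\<exists>y\<in>trace_class_ball. a = l *\<^sub>R r + (1 - l) *\<^sub>R y"
  \<comment> \<open>For \<open>l = 1\<close> the remainder is zero and cannot be rescaled, but its
    coefficient also vanishes, so any point of the ball serves as \<open>y\<close>.\<close>
  proof (cases "l = 1")
    case True
    then have "d = 0" using norm_le_trace_bound[OF td] by (intro blinfun_eqI) simp
    then show ?thesis
      using ad True rank_one_in_trace_class_ball[OF u1 v1] by (intro bexI[of _ r]) (auto simp: r_def)
  next
    case False
    then have l1: "1 - l > 0" using \<open>l \<le> 1\<close> by simp
    have "trace_le (inverse (1 - l) *\<^sub>R d) (inverse (1 - l) * (1 - l))"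
      using l1 by (intro trace_le_scaleR td) simp
    then have "inverse (1 - l) *\<^sub>R d \<in> trace_class_ball"
      using compact_operator_scaleR[OF d] l1 by (simp add: trace_class_ball_iff[OF nz])
    then show ?thesis using ad l1 by (intro bexI[of _ "inverse (1 - l) *\<^sub>R d"]) simp_all
  qed
  then show ?thesis using \<open>0 < l\<close> \<open>l \<le> 1\<close> u1 v1 unfolding r_def by blast
qed

text \<open>Apply the attained decomposition to \<open>e\<close> itself. Its rank one term has
  positive weight, so unless \<open>e\<close> equals that term, \<open>e\<close> lies strictly
  inside a segment of the ball.\<close>

lemma extreme_point_trace_class_ball:
  fixes e :: "'h::complex_hilbert_space \<Rightarrow>\<^sub>L 'h"
  assumes nz: "\<exists>v::'h. v \<noteq> 0" and e: "e extreme_point_of trace_class_ball"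
  shows "\<exists>u v. norm u = 1 \<and> norm v = 1 \<and> e = rank_one u v"
proof -
  have "e \<in> trace_class_ball" using e by (simp add: extreme_point_of_def)
  then obtain l u v y where l: "0 < l" "l \<le> 1" and uv: "norm u = 1" "norm v = 1"
    and y: "y \<in> trace_class_ball" and eq: "e = l *\<^sub>R rank_one u v + (1 - l) *\<^sub>R y"
    using attained_decomposition[OF nz _ refl] by blast
  have "e = rank_one u v"
  proof (cases "l = 1 \<or> y = rank_one u v")
    case True
    then show ?thesis using eq by (auto simp flip: scaleR_add_left)
  next
    case False
    then have "e \<in> open_segment y (rank_one u v)"
      unfolding in_segment using l eq by (intro conjI exI[of _ l]) (auto simp: add.commute)
    then show ?thesis using e y rank_one_in_trace_class_ball[OF uv] by (auto simp: extreme_point_of_def)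
  qed
  then show ?thesis using uv by blast
qed


section \<open>The upper bound\<close>

text \<open>
  A complex reflection carrying \<open>p\<close> to \<open>u\<close>: it differs from \<open>- id\<close> by a rank one operator of norm
  at most \<open>2\<close>. If \<open>u = - p\<close> then \<open>c = 1 / 0 = 0\<close>, and the formula is still correct.
\<close>

lemma complex_reflection:
  fixes p u :: "'h::complex_inner"
  assumes p: "norm p = 1" and u: "norm u = 1"
  defines "m \<equiv> p + u" and "c \<equiv> 1 / (1 + cinner p u)"
  defines "R \<equiv> \<lambda>x. (c * cinner x m) *\<^sub>C m - x"
  shows "R p = u" "cinner (R x) (R y) = cinner x y" "cmod c * (norm m)\<^sup>2 \<le> 2"
proof -
  define z where "z = cinner p u"
  have mm: "cinner m m = 2 + z + cnj z"
    using p u cinner_commute[of u p]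
    by (simp add: m_def cinner_simps cinner_self[of p] cinner_self[of u] z_def)
  have "complex_of_real ((norm m)\<^sup>2) = complex_of_real (2 + 2 * Re z)"
    using mm unfolding cinner_self by (simp add: complex_eq_iff)
  then have nm: "(norm m)\<^sup>2 = 2 + 2 * Re z" by (simp only: of_real_eq_iff)
  have pm: "cinner p m = 1 + z" using p by (simp add: m_def cinner_simps cinner_self z_def)
  have "cmod z \<le> 1" using norm_cinner_le[of p u] p u by (simp add: z_def)
  then have "\<bar>Re z\<bar> \<le> 1" using abs_Re_le_cmod[of z] by linarith
  have c: "c = 1 / (1 + z)" by (simp add: c_def z_def)
  have m0: "m = 0" if "1 + z = 0"
  proof -
    have "Re z = -1" using that by (simp add: complex_eq_iff)
    then show ?thesis using nm by simp
  qed
  show "R p = u"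
  proof (cases "1 + z = 0")
    case True
    then have "p + u = 0" using m0 by (simp add: m_def)
    then show ?thesis using m0[OF True] by (simp add: R_def add_eq_0_iff)
  next
    case False
    then have "c * cinner p m = 1" by (simp add: c pm)
    then show ?thesis by (simp add: R_def m_def)
  qed
  show "cmod c * (norm m)\<^sup>2 \<le> 2"
  proof (cases "1 + z = 0")
    case False
    have "1 + Re z \<le> cmod (1 + z)" using complex_Re_le_cmod[of "1 + z"] by simp
    then show ?thesis using False by (simp add: c nm norm_divide divide_simps)
  qed (simp add: m0)
  \<comment> \<open>Apart from the degenerate case,
    \<open>1 / c + 1 / cnj c = 2 + z + cnj z = cinner m m\<close>. Multiplied by
    \<open>c * cnj c\<close>, this is the cancellation that makes \<open>R\<close> preserve inner
    products.\<close>
  have key: "c * cnj c * cinner m m * w = c * w + cnj c * w" if "w = cinner x m * cnj (cinner y m)" for w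
  proof (cases "1 + z = 0")
    case True
    then show ?thesis using that m0 by simp
  next
    case False
    then have "1 + cnj z \<noteq> 0" by (metis complex_cnj_add complex_cnj_one complex_cnj_zero_iff)
    then show ?thesis using False unfolding mm c by (simp add: field_simps)
  qed
  have "cinner (R x) (R y) = cinner x y + (c * cnj c * cinner m m * (cinner x m * cnj (cinner y m))
      - (c * (cinner x m * cnj (cinner y m)) + cnj c * (cinner x m * cnj (cinner y m))))"
    using cinner_commute[of m y] by (simp add: R_def cinner_simps algebra_simps)
  then show "cinner (R x) (R y) = cinner x y" using key[OF refl] by simp
qed

text \<open>Since \<open>v\<close> is in the span of the \<open>x i\<close>, its counterpart
  \<open>p\<close> in the span of the \<open>f i\<close> is again a unit vector, and the reflection
  with \<open>R p = u\<close> exists. The rank one diagonal against \<open>R (f i)\<close> then sums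
  to \<open>cinner u (R p) = 1\<close>.\<close>

lemma trace_bound_v_in_span:
  fixes I :: "nat set" and b :: "'h::complex_hilbert_space \<Rightarrow>\<^sub>L 'h"
  assumes b: "b \<in> bounded_operators"
    and I: "finite I" and x: "orthonormal_on I x" and f: "orthonormal_on I f"
    and u: "norm u = 1" and v: "norm v = 1" "v = (\<Sum>i\<in>I. cinner v (x i) *\<^sub>C x i)"
    and c: "trace_le (t *\<^sub>R rank_one u v - b) c"
  shows "t + (\<Sum>i\<in>I. Re (cinner (blinfun_apply b (x i)) (f i))) - 2 * norm b \<le> c"
proof -
  define p where "p = (\<Sum>i\<in>I. cinner v (x i) *\<^sub>C f i)"
  have "(norm p)\<^sup>2 = (norm v)\<^sup>2"
    unfolding p_def norm_orthonormal_sum[OF I f] using norm_orthonormal_sum[OF I x] v(2) by metis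
  then have p: "norm p = 1" using v(1) by (metis norm_ge_zero power2_eq_iff_nonneg)
  define m where "m = p + u"
  define k where "k = 1 / (1 + cinner p u)"
  define R where "R = (\<lambda>x. (k * cinner x m) *\<^sub>C m - x)"
  have R: "R p = u" "cinner (R x) (R y) = cinner x y" and km: "cmod k * (norm m)\<^sup>2 \<le> 2" for x y
    unfolding R_def k_def m_def by (rule complex_reflection[OF p u])+
  have y: "orthonormal_on I (\<lambda>i. R (f i))"
    using f unfolding orthonormal_on_def R(2) .
  have "(\<Sum>i\<in>I. cinner v (x i) *\<^sub>C R (f i)) = R p"
  proof -
    have "cinner v (x i) *\<^sub>C R (f i)
        = (k * cinner (cinner v (x i) *\<^sub>C f i) m) *\<^sub>C m - cinner v (x i) *\<^sub>C f i" for i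
      by (simp add: R_def scaleC_diff_right scaleC_scaleC cinner_scaleC_left mult.left_commute)
    then have "(\<Sum>i\<in>I. cinner v (x i) *\<^sub>C R (f i))
        = (\<Sum>i\<in>I. (k * cinner (cinner v (x i) *\<^sub>C f i) m) *\<^sub>C m) - p"
      by (simp only: sum_subtractf p_def)
    also have "\<dots> = (k * cinner p m) *\<^sub>C m - p"
      unfolding p_def cinner_sum_left sum_distrib_left scaleC_sum_left ..
    finally show ?thesis by (simp only: R_def)
  qed
  then have Rp: "(\<Sum>i\<in>I. cinner v (x i) *\<^sub>C R (f i)) = u" using R(1) by simp
  have "(\<Sum>i\<in>I. cinner (x i) v * cinner u (R (f i))) = cinner u (\<Sum>i\<in>I. cinner v (x i) *\<^sub>C R (f i))"
    unfolding cinner_sum_right cinner_scaleC_right by (simp flip: cinner_commute)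
  also have "\<dots> = 1" unfolding Rp using u by (simp add: cinner_self)
  finally have 1: "(\<Sum>i\<in>I. cinner (x i) v * cinner u (R (f i))) = 1" .
  \<comment> \<open>Collects the rank one corrections of all test vectors into the single term
    \<open>cnj k * cinner (b z) m\<close>; Bessel keeps \<open>norm z \<le> norm m\<close>, so the
    cost does not grow with the size of \<open>I\<close>.\<close>
  define z where "z = (\<Sum>i\<in>I. cinner m (f i) *\<^sub>C x i)"
  have "(norm z)\<^sup>2 \<le> (norm m)\<^sup>2"
    unfolding z_def norm_orthonormal_sum[OF I x] by (rule bessel_inequality[OF I f])
  then have z: "norm z \<le> norm m" by (rule power2_le_imp_le) simp
  have 2: "(\<Sum>i\<in>I. cinner (blinfun_apply b (x i)) (R (f i)))
      = cnj k * cinner (blinfun_apply b z) m - (\<Sum>i\<in>I. cinner (blinfun_apply b (x i)) (f i))"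
  proof -
    have "cinner (blinfun_apply b (x i)) (R (f i))
        = cnj k * (cinner m (f i) * cinner (blinfun_apply b (x i)) m) - cinner (blinfun_apply b (x i)) (f i)" for i
      using cinner_commute[of m "f i"] by (simp add: R_def cinner_simps)
    moreover have "cinner (blinfun_apply b z) m = (\<Sum>i\<in>I. cinner m (f i) * cinner (blinfun_apply b (x i)) m)"
      by (simp add: z_def blinfun.sum_right bounded_operators_scaleC[OF b] cinner_sum_left cinner_scaleC_left)
    ultimately show ?thesis by (simp add: sum_subtractf sum_distrib_left)
  qed
  have "cmod (cnj k * cinner (blinfun_apply b z) m) \<le> cmod k * ((norm b * norm m) * norm m)"
    unfolding norm_mult complex_mod_cnj
    using norm_blinfun[of b z] mult_left_mono[OF z, of "norm b"]
    by (intro mult_left_mono order_trans[OF norm_cinner_le] mult_right_mono) auto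
  also have "\<dots> = norm b * (cmod k * (norm m)\<^sup>2)" by (simp add: power2_eq_square)
  also have "\<dots> \<le> norm b * 2" by (intro mult_left_mono km) simp
  finally have 3: "Re (cnj k * cinner (blinfun_apply b z) m) \<le> 2 * norm b"
    using complex_Re_le_cmod[of "cnj k * cinner (blinfun_apply b z) m"] by linarith
  have Re_t: "Re (complex_of_real t * q) = t * Re q" for q by simp
  have "(\<Sum>i\<in>I. Re (cinner (blinfun_apply (t *\<^sub>R rank_one u v - b) (x i)) (R (f i))))
      = t * Re (\<Sum>i\<in>I. cinner (x i) v * cinner u (R (f i)))
        - Re (\<Sum>i\<in>I. cinner (blinfun_apply b (x i)) (R (f i)))"
    by (simp add: blinfun.diff_left blinfun.scaleR_left rank_one_apply cinner_diff_left
        cinner_scaleR_left cinner_scaleC_left sum_subtractf sum_distrib_left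
        Re_t del: times_complex.sel)
  also have "\<dots> = t - Re (cnj k * cinner (blinfun_apply b z) m)
      + (\<Sum>i\<in>I. Re (cinner (blinfun_apply b (x i)) (f i)))"
    unfolding 1 2 by simp
  finally show ?thesis using trace_leD[OF c I x y] 3 by linarith
qed

text \<open>Passing to adjoints exchanges \<open>u\<close> with \<open>v\<close> and
  \<open>x\<close> with \<open>f\<close>, which reduces this to the case of \<open>v\<close> in the
  span.\<close>

lemma trace_bound_u_in_span:
  fixes I :: "nat set" and b :: "'h::complex_hilbert_space \<Rightarrow>\<^sub>L 'h"
  assumes b: "b \<in> bounded_operators"
    and I: "finite I" and x: "orthonormal_on I x" and f: "orthonormal_on I f"
    and u: "norm u = 1" "u = (\<Sum>i\<in>I. cinner u (f i) *\<^sub>C f i)" and v: "norm v = 1"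
    and c: "trace_le (t *\<^sub>R rank_one u v - b) c"
  shows "t + (\<Sum>i\<in>I. Re (cinner (blinfun_apply b (x i)) (f i))) - 2 * norm b \<le> c"
proof -
  let ?d = "t *\<^sub>R rank_one u v - b"
  have d: "?d \<in> bounded_operators"
    using b rank_one_bounded[of u v]
    by (simp add: bounded_operators_def blinfun.diff_left blinfun.scaleR_left scaleC_diff_right
        scaleR_eq_scaleC scaleC_scaleC mult.commute)
  have "cadjoint ?d = t *\<^sub>R rank_one v u - cadjoint b"
  proof (rule blinfun_eqI, rule cinner_extensionality)
    fix y z
    have "cinner z (blinfun_apply (cadjoint ?d) y) = cinner (blinfun_apply ?d z) y"
      by (simp only: cinner_cadjoint[OF d])
    also have "\<dots> = cinner z (blinfun_apply (t *\<^sub>R rank_one v u - cadjoint b) y)"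
      using cinner_commute[of u y]
      by (simp add: blinfun.diff_left blinfun.scaleR_left rank_one_apply cinner_simps cinner_cadjoint[OF b])
    finally show "cinner z (blinfun_apply (cadjoint ?d) y)
      = cinner z (blinfun_apply (t *\<^sub>R rank_one v u - cadjoint b) y)" .
  qed
  then have "trace_le (t *\<^sub>R rank_one v u - cadjoint b) c"
    using trace_le_cadjoint[OF d c] by simp
  from trace_bound_v_in_span[OF cadjoint_bounded[OF b] I f x v u this]
  have "t + (\<Sum>i\<in>I. Re (cinner (blinfun_apply (cadjoint b) (f i)) (x i))) - 2 * norm (cadjoint b) \<le> c" .
  moreover have "Re (cinner (blinfun_apply (cadjoint b) (f i)) (x i)) = Re (cinner (blinfun_apply b (x i)) (f i))" for i
    unfolding cinner_cadjoint_left[OF b] by (simp add: inner_commute flip: inner_eq_Re_cinner)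
  moreover have "norm (cadjoint b) \<le> norm b" by (rule norm_cadjoint_le[OF b])
  ultimately show ?thesis by simp
qed

text \<open>One Gram-Schmidt step. The sign \<open>w\<close> stays free so that the new diagonal
  term can later be made nonnegative.\<close>

lemma orthonormal_on_insert_residual:
  assumes I: "finite I" "n \<notin> I" and x: "orthonormal_on I x" and w: "\<bar>w\<bar> = (1::real)"
    and d: "d = z - (\<Sum>i\<in>I. cinner z (x i) *\<^sub>C x i)" "d \<noteq> 0"
  shows "orthonormal_on (insert n I) (x(n := w *\<^sub>R sgn d))"
proof -
  have dx: "cinner d (x i) = 0" if "i \<in> I" for i
    unfolding d(1) by (simp add: cinner_diff_left cinner_orthonormal_sum[OF I(1) x that])
  then have xd: "cinner (x i) d = 0" if "i \<in> I" for i
    using that cinner_commute[of "x i" d] by simp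
  have "cinner (w *\<^sub>R sgn d) (w *\<^sub>R sgn d) = 1" using w d(2) by (simp add: cinner_self norm_sgn)
  then show ?thesis using I(2) x
    by (auto simp: orthonormal_on_def sgn_div_norm cinner_scaleR_left cinner_scaleR_right dx xd)
qed

lemma span_insert_residual:
  assumes I: "finite I" "n \<notin> I" and x: "orthonormal_on I x"
    and d: "d = z - (\<Sum>i\<in>I. cinner z (x i) *\<^sub>C x i)" "d \<noteq> 0"
  shows "z = (\<Sum>i\<in>insert n I. cinner z ((x(n := sgn d)) i) *\<^sub>C (x(n := sgn d)) i)"
proof -
  have "cinner d (x i) = 0" if "i \<in> I" for i
    unfolding d(1) by (simp add: cinner_diff_left cinner_orthonormal_sum[OF I(1) x that])
  then have xd: "cinner (x i) d = 0" if "i \<in> I" for i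
    using that cinner_commute[of "x i" d] by simp
  have "cinner z d = cinner d d + cinner (\<Sum>i\<in>I. cinner z (x i) *\<^sub>C x i) d"
    by (simp add: d(1) flip: cinner_add_left)
  also have "\<dots> = cinner d d" by (simp add: cinner_sum_left cinner_scaleC_left xd)
  finally have "cinner z (sgn d) = complex_of_real (norm d)"
    using d(2) by (simp add: sgn_div_norm cinner_scaleR_right cinner_self power2_eq_square)
  then have "cinner z (sgn d) *\<^sub>C sgn d = d"
    using d(2) by (simp add: sgn_div_norm flip: scaleR_eq_scaleC)
  moreover have "(\<Sum>i\<in>I. cinner z ((x(n := sgn d)) i) *\<^sub>C (x(n := sgn d)) i) = z - d"
    unfolding d(1) using I(2) by (auto intro!: sum.cong)
  ultimately show ?thesis using I by simp
qed

text \<open>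
  If neither span condition holds, both families can be enlarged by one vector so that \<open>v\<close> is in
  the span of the first; a sign makes the new diagonal term nonnegative.
\<close>

lemma trace_bound:
  fixes I :: "nat set" and b :: "'h::complex_hilbert_space \<Rightarrow>\<^sub>L 'h"
  assumes b: "b \<in> bounded_operators"
    and I: "finite I" and x: "orthonormal_on I x" and f: "orthonormal_on I f"
    and u: "norm u = 1" and v: "norm v = 1"
    and c: "trace_le (t *\<^sub>R rank_one u v - b) c"
  shows "t + (\<Sum>i\<in>I. Re (cinner (blinfun_apply b (x i)) (f i))) - 2 * norm b \<le> c"
proof -
  define d where "d = v - (\<Sum>i\<in>I. cinner v (x i) *\<^sub>C x i)"
  define g where "g = u - (\<Sum>i\<in>I. cinner u (f i) *\<^sub>C f i)"
  \<comment> \<open>Both families must keep the same index set, so adjoining the residual of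
    \<open>v\<close> to \<open>x\<close> needs a new direction for \<open>f\<close> as well. The
    residual \<open>g\<close> of \<open>u\<close> provides one; if it is zero, \<open>u\<close> is
    already in the span and the adjoint version applies.\<close>
  consider "d = 0" | "g = 0" | "d \<noteq> 0" "g \<noteq> 0" by blast
  then show ?thesis
  proof cases
    case 1
    then have "v = (\<Sum>i\<in>I. cinner v (x i) *\<^sub>C x i)" by (simp add: d_def)
    then show ?thesis by (rule trace_bound_v_in_span[OF b I x f u v _ c])
  next
    case 2
    then have "u = (\<Sum>i\<in>I. cinner u (f i) *\<^sub>C f i)" by (simp add: g_def)
    then show ?thesis by (rule trace_bound_u_in_span[OF b I x f u _ v c])
  next
    case 3
    obtain n where n: "n \<notin> I" using ex_new_if_finite[OF infinite_UNIV_nat I] by blast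
    define w :: real where "w = (if Re (cinner (blinfun_apply b (sgn d)) (sgn g)) \<ge> 0 then 1 else - 1)"
    have x': "orthonormal_on (insert n I) (x(n := sgn d))"
      using orthonormal_on_insert_residual[OF I n x _ d_def 3(1), of 1] by simp
    have f': "orthonormal_on (insert n I) (f(n := w *\<^sub>R sgn g))"
      by (rule orthonormal_on_insert_residual[OF I n f _ g_def 3(2)]) (simp add: w_def)
    have "t + (\<Sum>i\<in>insert n I. Re (cinner (blinfun_apply b ((x(n := sgn d)) i)) ((f(n := w *\<^sub>R sgn g)) i)))
        - 2 * norm b \<le> c"
      using I by (intro trace_bound_v_in_span[OF b _ x' f' u v span_insert_residual[OF I n x d_def 3(1)] c]) simp
    moreover have "(\<Sum>i\<in>insert n I. Re (cinner (blinfun_apply b ((x(n := sgn d)) i)) ((f(n := w *\<^sub>R sgn g)) i)))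
        = w * Re (cinner (blinfun_apply b (sgn d)) (sgn g)) + (\<Sum>i\<in>I. Re (cinner (blinfun_apply b (x i)) (f i)))"
    proof -
      have "(\<Sum>i\<in>I. Re (cinner (blinfun_apply b ((x(n := sgn d)) i)) ((f(n := w *\<^sub>R sgn g)) i)))
          = (\<Sum>i\<in>I. Re (cinner (blinfun_apply b (x i)) (f i)))"
        using n by (intro sum.cong) auto
      then show ?thesis using I n by (simp add: cinner_scaleR_right)
    qed
    moreover have "w * Re (cinner (blinfun_apply b (sgn d)) (sgn g)) \<ge> 0" by (simp add: w_def)
    ultimately show ?thesis by linarith
  qed
qed

lemma amenable_upper_bound:
  fixes a :: "'h::complex_hilbert_space \<Rightarrow>\<^sub>L 'h"
  assumes nz: "\<exists>v::'h. v \<noteq> 0" and a: "a \<in> trace_class_ball"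
    and am: "amenable trace_class_ball (e, y, t) a"
  shows "t \<le> (1 - trace_norm a + 2 * norm a) / 2"
proof -
  have e: "e extreme_point_of trace_class_ball" and y: "y \<in> trace_class_ball"
    and t: "0 \<le> t" "t \<le> 1" and eq: "a = t *\<^sub>R e + (1 - t) *\<^sub>R y"
    using am by (auto simp: amenable_def)
  obtain u v where uv: "norm u = 1" "norm v = 1" and r: "e = rank_one u v"
    using extreme_point_trace_class_ball[OF nz e] by blast
  have c: "compact_operator a" using a by (simp add: trace_class_ball_def trace_class_def)
  then have aB: "a \<in> bounded_operators" by (simp add: compact_operator_def)
  obtain E where E: "singular_basis a E" using singular_basis_exists[OF c nz] by blast
  have "trace_le ((1 - t) *\<^sub>R (- y)) ((1 - t) * 1)"
    using y t by (intro trace_le_scaleR trace_le_uminus) (auto simp: trace_class_ball_iff[OF nz])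
  moreover have "(1 - t) *\<^sub>R (- y) = t *\<^sub>R rank_one u v - a" by (simp add: eq r)
  ultimately have le: "trace_le (t *\<^sub>R rank_one u v - a) (1 - t)" by simp
  \<comment> \<open>The bound is the same for every finite part of the singular basis, hence holds
    for the whole sum; finite families are all the reflection argument can handle.\<close>
  have "trace_norm a \<le> 1 - 2 * t + 2 * norm a"
  proof (rule has_sum_le_finite_sums[OF trace_class_ball_singular[OF a E]])
    fix F assume F: "finite F" "F \<subseteq> E"
    obtain I :: "nat set" and x f where "finite I" "orthonormal_on I x" "orthonormal_on I f"
      and S: "(\<Sum>i\<in>I. Re (cinner (blinfun_apply a (x i)) (f i))) = (\<Sum>e\<in>F. norm (blinfun_apply a e))"
      using singular_families[OF E F] by blast
    from trace_bound[OF aB this(1-3) uv le]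
    show "(\<Sum>e\<in>F. norm (blinfun_apply a e)) \<le> 1 - 2 * t + 2 * norm a" unfolding S by simp
  qed
  then show ?thesis by simp
qed

theorem theorem2p4:
  assumes "\<exists>v :: 'h::complex_hilbert_space. v \<noteq> 0"
  shows "\<forall>a \<in> (trace_class_ball :: ('h \<Rightarrow>\<^sub>L 'h) set).
    lambda_function trace_class_ball a = (1 - trace_norm a + 2 * norm a) / 2 \<and>
    (\<exists>e y. e extreme_point_of trace_class_ball \<and> y \<in> trace_class_ball \<and>
      a = lambda_function trace_class_ball a *\<^sub>R e
        + (1 - lambda_function trace_class_ball a) *\<^sub>R y)"
proof
  fix a :: "'h \<Rightarrow>\<^sub>L 'h" assume a: "a \<in> trace_class_ball"
  define l where "l = (1 - trace_norm a + 2 * norm a) / 2"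
  obtain u v y where l: "0 < l" "l \<le> 1" and uv: "norm u = 1" "norm v = 1"
    and y: "y \<in> trace_class_ball" and eq: "a = l *\<^sub>R rank_one u v + (1 - l) *\<^sub>R y"
    using attained_decomposition[OF assms a l_def] by blast
  note e = rank_one_extreme_point[OF uv]
  have "amenable trace_class_ball (rank_one u v, y, l) a"
    using e y l eq by (simp add: amenable_def)
  \<comment> \<open>The weight \<open>l\<close> belongs to the set of amenable weights and bounds
    it, so the supremum is a maximum; the same decomposition then witnesses attainment.\<close>
  then have lam: "lambda_function trace_class_ball a = l"
    unfolding lambda_function_def
    by (intro cSup_eq_maximum) (auto simp: l_def dest: amenable_upper_bound[OF assms a])
  show "lambda_function trace_class_ball a = (1 - trace_norm a + 2 * norm a) / 2 \<and>
    (\<exists>e y. e extreme_point_of trace_class_ball \<and> y \<in> trace_class_ball \<and>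
      a = lambda_function trace_class_ball a *\<^sub>R e + (1 - lambda_function trace_class_ball a) *\<^sub>R y)"
    unfolding lam by (intro conjI l_def exI[of _ "rank_one u v"] exI[of _ y] e y eq)
qed

end
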